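(* Let $\mu:\mathcal{P}(\mathbb{R}^n)\to\mathbb{R}$ be an $\operatorname{O}(n)$-invariant valuation such that $\mu(D)=0$ for every $D\in\mathcal{P}(\mathbb{R}^n)$ which satisfies $\dim D<n$ or which contains a line. Let $\psi(a)=\mu(C(a))$ for $a\in\mathbb{R}_{>0}^n$, let $\Sigma=\mathbb{S}^{n-1}\cap\mathbb{R}_{>0}^n$, and suppose $\psi|_\Sigma\in L^1(\Sigma,\sigma)$, i.e. $\psi|_\Sigma$ is measurable and $\int_\Sigma|\psi(a)|\,\mathrm{d}\sigma(a)<\infty$. Then $\mu(C)=0$ for every full-dimensional simplicial cone $C\subseteq\mathbb{R}^n$. Moreover, $\mu$ vanishes on all polyhedral cones in $\mathbb{R}^n$.
   Context: $\operatorname{pos}$ denotes the set of nonnegative linear combinations. $\mathcal{P}(\mathbb{R}^n)$ is the set of polyhedral cones in $\mathbb{R}^n$, i.e. sets $\operatorname{pos}(x_1,\ldots,x_m)$ with finitely many $x_i\in\mathbb{R}^n$ (the empty list gives $\{0\}$). A cone is simplicial if the generators can be chosen linearly independent; the dimension of a cone is that of its linear span, and it is full-dimensional if this is $n$. A line is a one-dimensional linear subspace. A real valuation on $\mathcal{P}(\mathbb{R}^n)$ is a map $\mu:\mathcal{P}(\mathbb{R}^n)\to\mathbb{R}$ with $\mu(D\cup E)+\mu(D\cap E)=\mu(D)+\mu(E)$ whenever $D,E,D\cup E\in\mathcal{P}(\mathbb{R}^n)$; it is $\operatorname{O}(n)$-invariant if $\mu(gD)=\mu(D)$ for all $g\in\operatorname{O}(n)$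 and all $D$. No continuity is assumed. For $a\in\mathbb{R}^n$, with $e_1,\ldots,e_n$ the standard basis, $x_i(a)=\sum_{j=1}^i a_je_j$ and $C(a)=\operatorname{pos}(x_1(a),\ldots,x_n(a))$. $\sigma$ is the normalised uniform (rotation-invariant probability) measure on $\mathbb{S}^{n-1}$. *)

theory Defs
  imports "HOL-Analysis.Analysis"
begin

definition pos_hull :: "'a::real_vector set \<Rightarrow> 'a set" where
  "pos_hull S = {\<Sum>v\<in>T. c v *\<^sub>R v | T c. finite T \<and> T \<subseteq> S \<and> (\<forall>v\<in>T. 0 \<le> c v)}"

definition polyhedral_cone :: "'a::real_vector set \<Rightarrow> bool" where
  "polyhedral_cone C \<longleftrightarrow> (\<exists>S. finite S \<and> C = pos_hull S)"

definition simplicial_cone :: "'a::real_vector set \<Rightarrow> bool" where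
  "simplicial_cone C \<longleftrightarrow> (\<exists>S. finite S \<and> independent S \<and> C = pos_hull S)"

definition contains_line :: "'a::euclidean_space set \<Rightarrow> bool" where
  "contains_line D \<longleftrightarrow> (\<exists>L. subspace L \<and> dim L = 1 \<and> L \<subseteq> D)"

text \<open>A function on polyhedral cones is represented by a function on all sets, of which only the
  values at polyhedral cones are ever used.\<close>

definition cone_valuation :: "('a::real_vector set \<Rightarrow> real) \<Rightarrow> bool" where
  "cone_valuation \<mu> \<longleftrightarrow>
    (\<forall>D E. polyhedral_cone D \<longrightarrow> polyhedral_cone E \<longrightarrow> polyhedral_cone (D \<union> E) \<longrightarrow>
      \<mu> (D \<union> E) + \<mu> (D \<inter> E) = \<mu> D + \<mu> E)"

definition orthogonally_invariant :: "('a::euclidean_space set \<Rightarrow> real) \<Rightarrow> bool" where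
  "orthogonally_invariant \<mu> \<longleftrightarrow>
    (\<forall>g D. orthogonal_transformation g \<longrightarrow> polyhedral_cone D \<longrightarrow> \<mu> (g ` D) = \<mu> D)"

text \<open>The linear order of the index type stands for the numbering of the standard basis.\<close>

definition partial_sum_vec :: "real ^ 'n::{finite,wellorder} \<Rightarrow> 'n \<Rightarrow> real ^ 'n::_" where
  "partial_sum_vec a i = (\<Sum>j\<in>{..i}. (a $ j) *\<^sub>R axis j 1)"

definition path_cone :: "real ^ 'n::{finite,wellorder} \<Rightarrow> (real ^ 'n::_) set" where
  "path_cone a = pos_hull (range (partial_sum_vec a))"

definition positive_sphere :: "(real ^ 'n) set" where
  "positive_sphere = sphere 0 1 \<inter> {a. \<forall>i. 0 < a $ i}"

text \<open>Invariance is required under all orthogonal maps, not only those of determinant one; this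
  only matters on the real line, where proper rotations alone do not determine the measure.\<close>

definition uniform_sphere_measure :: "'a::euclidean_space measure \<Rightarrow> bool" where
  "uniform_sphere_measure \<sigma> \<longleftrightarrow>
    sets \<sigma> = sets (restrict_space borel (sphere 0 1)) \<and>
    emeasure \<sigma> (sphere 0 1) = 1 \<and>
    (\<forall>g A. orthogonal_transformation g \<longrightarrow> A \<in> sets \<sigma> \<longrightarrow> emeasure \<sigma> (g ` A) = emeasure \<sigma> A)"

text \<open>Existence: the radial projection of the uniform measure on the unit ball.\<close>

lemma uniform_sphere_measure_exists:
  "\<exists>\<sigma> :: (real ^ 'n::{finite,wellorder}) measure. uniform_sphere_measure \<sigma>"
proof -
  let ?B = "cball (0 :: real ^ 'n::_) 1" and ?R = "restrict_space borel (sphere (0 :: real ^ 'n::_) 1)"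
  define U where "U = uniform_measure lborel ?B"
  define f :: "real ^ 'n::_ \<Rightarrow> real ^ 'n::_" where "f x = (if x = 0 then axis undefined 1 else sgn x)" for x
  define \<sigma> where "\<sigma> = distr U ?R f"
  have spB: "emeasure lborel ?B \<noteq> 0" "emeasure lborel ?B \<noteq> \<infinity>"
    by (auto simp: emeasure_cball unit_ball_vol_pos[THEN less_imp_neq, THEN not_sym])
  have setsU: "sets U = sets borel" by (simp add: U_def)
  have "f \<in> borel_measurable borel" unfolding f_def sgn_div_norm by measurable
  then have fR: "f \<in> measurable U ?R"
    by (auto simp: measurable_restrict_space2_iff measurable_cong_sets[OF setsU refl] f_def norm_sgn)
  have eU: "emeasure \<sigma> A = emeasure lborel (?B \<inter> (f -` A - {0})) / emeasure lborel ?B"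
    if A: "A \<in> sets ?R" for A
  proof -
    have pre: "f -` A \<in> sets borel"
      using measurable_sets[OF fR A] by (simp add: U_def)
    have "emeasure \<sigma> A = emeasure U (f -` A)"
      using A fR by (simp add: \<sigma>_def emeasure_distr U_def)
    also have "\<dots> = emeasure lborel (?B \<inter> f -` A) / emeasure lborel ?B"
      unfolding U_def using pre by (subst emeasure_uniform_measure) auto
    also have "emeasure lborel (?B \<inter> f -` A) = emeasure lborel (?B \<inter> f -` A - {0})"
      using pre by (intro emeasure_Diff_null_set[symmetric]) auto
    also have "?B \<inter> f -` A - {0} = ?B \<inter> (f -` A - {0})" by blast
    finally show ?thesis .
  qed
  have "emeasure \<sigma> (sphere 0 1) = 1"
  proof -
    have S: "sphere (0 :: real ^ 'n::_) 1 \<in> sets ?R" by (auto simp: sets_restrict_space)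
    have "f -` sphere 0 1 = UNIV" by (auto simp: f_def norm_sgn)
    moreover have "emeasure lborel (?B \<inter> (UNIV - {0})) = emeasure lborel ?B"
      unfolding Diff_eq Int_UNIV_left unfolding Diff_eq[symmetric]
      by (intro emeasure_Diff_null_set) auto
    ultimately show ?thesis
      using spB by (simp add: eU[OF S] ennreal_divide_self less_top del: Diff_UNIV)
  qed
  moreover have "emeasure \<sigma> (g ` A) = emeasure \<sigma> A"
    if g: "orthogonal_transformation g" and A: "A \<in> sets \<sigma>" for g A
  proof -
    have A': "A \<in> sets ?R" using A by (simp add: \<sigma>_def)
    have AB: "A \<in> sets borel" "A \<subseteq> sphere 0 1"
      using A' by (auto simp: sets_restrict_space)
    have lin: "linear g" and inj: "inj g" and bij: "bij g" and ng: "\<And>x. norm (g x) = norm x"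
      using g by (auto simp: orthogonal_transformation orthogonal_transformation_inj
          orthogonal_transformation_bij)
    have og: "orthogonal_transformation (inv g)"
      by (rule orthogonal_transformation_inv[OF g])
    have borel_image: "g ` X \<in> sets borel" if "X \<in> sets borel" for X
    proof -
      have "inv g \<in> borel_measurable borel"
        using orthogonal_transformation_linear[OF og]
        by (intro borel_measurable_continuous_onI linear_continuous_on)
           (simp add: linear_conv_bounded_linear)
      then have "inv g -` X \<in> sets borel"
        using that measurable_sets[of "inv g" borel borel X] by simp
      then show ?thesis by (simp add: bij bij_vimage_eq_inv_image bij_imp_bij_inv inv_inv_eq)
    qed
    have gA: "g ` A \<in> sets ?R"
    proof -
      have "g ` A \<subseteq> sphere 0 1" using AB ng by auto
      then show ?thesis using borel_image[OF AB(1)] by (auto simp: sets_restrict_space)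
    qed
    have gf: "g (f x) = f (g x)" if "x \<noteq> 0" for x
      using that lin ng[of x] by (auto simp: f_def sgn_div_norm linear_cmul)
    have g0: "g x = 0 \<longleftrightarrow> x = 0" for x using ng[of x] by (metis norm_eq_zero)
    let ?X = "?B \<inter> (f -` A - {0})"
    have pre: "?X \<in> sets borel"
      using measurable_sets[OF fR A'] by (auto simp: U_def)
    have eq: "?B \<inter> (f -` (g ` A) - {0}) = g ` ?X"
    proof (intro equalityI subsetI)
      fix y assume y: "y \<in> ?B \<inter> (f -` (g ` A) - {0})"
      obtain x where x: "y = g x" using bij by (metis bij_pointE)
      have x0: "x \<noteq> 0" using y g0[of x] by (simp add: x)
      have "g (f x) \<in> g ` A" using y by (simp add: x gf[OF x0])
      then have "f x \<in> A" by (simp add: inj_image_mem_iff[OF inj])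
      then show "y \<in> g ` ?X" using y x0 by (auto simp: x ng)
    next
      fix y assume "y \<in> g ` ?X"
      then obtain x where "y = g x" "x \<in> ?X" by blast
      then have x: "y = g x" "norm x \<le> 1" "f x \<in> A" "x \<noteq> 0" by auto
      then show "y \<in> ?B \<inter> (f -` (g ` A) - {0})"
        using gf[OF x(4)] g0[of x] by (auto simp: ng simp flip: gf)
    qed
    have lm: "?X \<in> lmeasurable"
    proof (rule bounded_set_imp_lmeasurable)
      show "bounded ?X" by (rule bounded_Int) simp
      show "?X \<in> sets lebesgue" using pre by (auto intro: sets_completionI_sets)
    qed
    have gX: "g ` ?X \<in> lmeasurable" by (rule measurable_orthogonal_image[OF g lm])
    have "emeasure lborel (g ` ?X) = emeasure lebesgue (g ` ?X)"
      using borel_image[OF pre] by simp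
    also have "\<dots> = emeasure lebesgue ?X"
      using measure_orthogonal_image[OF g lm] lm gX by (simp add: emeasure_eq_measure2)
    also have "\<dots> = emeasure lborel ?X" using pre by simp
    finally show ?thesis by (simp add: eU[OF gA] eU[OF A'] eq)
  qed
  ultimately have "uniform_sphere_measure \<sigma>"
    by (simp add: uniform_sphere_measure_def \<sigma>_def)
  then show ?thesis ..
qed

end

theory Submission
  imports Defs
begin

text \<open>Vanishing on cones with lines gives \<open>\<mu>(pos S) = \<mu>(pos (S, a)) + \<mu>(pos (S, -a))\<close> for every
  \<open>a \<noteq> 0\<close>. Hence \<open>G(y\<^sub>1, \<dots>, y\<^sub>n) = sgn det(y) \<mu>(pos(y\<^sub>1, \<dots>, y\<^sub>n))\<close> depends only on the lines spanned by
  the \<open>y\<^sub>i\<close> and is a cocycle: \<open>G(y)\<close> is the sum of the values obtained by replacing each \<open>y\<^sub>i\<close> in turn by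
  a fixed \<open>z \<noteq> 0\<close>. Replacing first by a random point \<open>v\<close> of the sphere, then by its projections to
  the spans of the remaining \<open>y\<^sub>i\<close>, and so on down, writes \<open>G(y)\<close> as a signed sum of values on
  orthoschemes whose edge lengths \<open>a\<close> are the absolute values of the coordinates of \<open>v\<close> in orthonormal frames.
  Each summand is integrable in \<open>v\<close> by the hypothesis on \<open>\<psi>\<close> and odd under the reflection that
  changes the sign of one coordinate, so its mean is zero; as \<open>G(y)\<close> does not depend on \<open>v\<close>, it vanishes.
  For a cone with linearly dependent generators, flipping the signs of generators changes \<open>\<mu>\<close> only by
  a sign, modulo cones with fewer generators, and suitable flips turn the dependency into a line.\<close>

subsection \<open>Cones and valuations vanishing on lines\<close>

text \<open>The set of nonnegative combinations is itself a convex cone around \<open>S\<close>, so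
  minimality of the hull applies. The identity makes the hull calculus for convex cones
  available.\<close>

lemma pos_hull_eq_convex_cone_hull: "pos_hull S = convex_cone hull S"
proof
  show "pos_hull S \<subseteq> convex_cone hull S"
  proof
    fix x assume "x \<in> pos_hull S"
    then obtain T c where T: "finite T" "T \<subseteq> S" "\<forall>v\<in>T. 0 \<le> c v" and x: "x = (\<Sum>v\<in>T. c v *\<^sub>R v)"
      by (auto simp: pos_hull_def)
    show "x \<in> convex_cone hull S"
      using T unfolding x
    proof (induction T rule: finite_induct)
      case (insert a T)
      then show ?case
        by (simp add: convex_cone_hull_add convex_cone_hull_mul hull_inc)
    qed (simp add: convex_cone_hull_contains_0)
  qed
  have "S \<subseteq> pos_hull S"
  proof
    fix x assume "x \<in> S"
    then show "x \<in> pos_hull S"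
      unfolding pos_hull_def by (intro CollectI exI[of _ "{x}"] exI[of _ "\<lambda>_. 1"]) auto
  qed
  moreover have "convex_cone (pos_hull S)"
    unfolding convex_cone_iff
  proof (intro conjI ballI allI impI)
    show "0 \<in> pos_hull S"
      unfolding pos_hull_def by (intro CollectI exI[of _ "{}"]) auto
    show "c *\<^sub>R x \<in> pos_hull S" if x: "x \<in> pos_hull S" and c: "0 \<le> c" for c x
    proof -
      obtain T d where "finite T" "T \<subseteq> S" "\<forall>v\<in>T. 0 \<le> d v" "x = (\<Sum>v\<in>T. d v *\<^sub>R v)"
        using x by (auto simp: pos_hull_def)
      then show ?thesis
        unfolding pos_hull_def using c
        by (intro CollectI exI[of _ T] exI[of _ "\<lambda>v. c * d v"]) (auto simp: scaleR_sum_right)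
    qed
    show "x + y \<in> pos_hull S" if x: "x \<in> pos_hull S" and y: "y \<in> pos_hull S" for x y
    proof -
      obtain T c where T: "finite T" "T \<subseteq> S" "\<forall>v\<in>T. 0 \<le> c v" "x = (\<Sum>v\<in>T. c v *\<^sub>R v)"
        using x by (auto simp: pos_hull_def)
      obtain U d where U: "finite U" "U \<subseteq> S" "\<forall>v\<in>U. 0 \<le> d v" "y = (\<Sum>v\<in>U. d v *\<^sub>R v)"
        using y by (auto simp: pos_hull_def)
      \<comment> \<open>Extending the coefficients by 0 lets both sums run over
        \<open>T \<union> U\<close>, so that they can be added termwise.\<close>
      let ?c = "\<lambda>v. if v \<in> T then c v else 0" and ?d = "\<lambda>v. if v \<in> U then d v else 0"
      have "x = (\<Sum>v\<in>T \<union> U. ?c v *\<^sub>R v)" "y = (\<Sum>v\<in>T \<union> U. ?d v *\<^sub>R v)"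
        unfolding T(4) U(4) using T(1) U(1) by (auto intro!: sum.mono_neutral_cong_left)
      then have "x + y = (\<Sum>v\<in>T \<union> U. (?c v + ?d v) *\<^sub>R v)"
        by (simp add: scaleR_add_left sum.distrib)
      then show ?thesis
        unfolding pos_hull_def using T U
        by (intro CollectI exI[of _ "T \<union> U"] exI[of _ "\<lambda>v. ?c v + ?d v"]) auto
    qed
  qed
  ultimately show "convex_cone hull S \<subseteq> pos_hull S"
    by (rule hull_minimal)
qed

lemma polyhedral_cone_pos_hull [simp]: "finite S \<Longrightarrow> polyhedral_cone (pos_hull S)"
  by (auto simp: polyhedral_cone_def)

lemma pos_hull_linear_image: "linear f \<Longrightarrow> pos_hull (f ` S) = f ` pos_hull S"
  by (simp add: pos_hull_eq_convex_cone_hull convex_cone_hull_linear_image)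

lemma pos_hull_mono: "S \<subseteq> T \<Longrightarrow> pos_hull S \<subseteq> pos_hull T"
  by (simp add: pos_hull_eq_convex_cone_hull hull_mono)

lemma pos_hull_superset: "S \<subseteq> pos_hull S"
  by (simp add: pos_hull_eq_convex_cone_hull hull_subset)

lemma zero_in_pos_hull: "0 \<in> pos_hull S"
  by (simp add: pos_hull_eq_convex_cone_hull convex_cone_hull_contains_0)

lemma pos_hull_add: "x \<in> pos_hull S \<Longrightarrow> y \<in> pos_hull S \<Longrightarrow> x + y \<in> pos_hull S"
  by (simp add: pos_hull_eq_convex_cone_hull convex_cone_hull_add)

lemma pos_hull_scaleR: "x \<in> pos_hull S \<Longrightarrow> 0 \<le> c \<Longrightarrow> c *\<^sub>R x \<in> pos_hull S"
  by (simp add: pos_hull_eq_convex_cone_hull convex_cone_hull_mul)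

lemma pos_hull_sum: "(\<And>i. i \<in> A \<Longrightarrow> f i \<in> pos_hull S) \<Longrightarrow> (\<Sum>i\<in>A. f i) \<in> pos_hull S"
  by (induction A rule: infinite_finite_induct) (auto simp: zero_in_pos_hull pos_hull_add)

lemma pos_hull_insert_absorb: "a \<in> pos_hull S \<Longrightarrow> pos_hull (insert a S) = pos_hull S"
  by (simp add: pos_hull_eq_convex_cone_hull hull_redundant)

lemma pos_hull_subset_span: "pos_hull S \<subseteq> span S"
  unfolding pos_hull_eq_convex_cone_hull by (intro hull_minimal span_superset convex_cone_span)

text \<open>The hull of a union is the Minkowski sum of the hulls, and the hull of
  \<open>{a}\<close> is a ray. Generators can thus be peeled off one at a time.\<close>

lemma pos_hull_insert_iff:
  "x \<in> pos_hull (insert a S) \<longleftrightarrow> (\<exists>t\<ge>0. \<exists>w\<in>pos_hull S. x = t *\<^sub>R a + w)"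
proof -
  have "convex_cone hull {a} = {t *\<^sub>R a |t. 0 \<le> t}"
    by (auto simp: convex_cone_hull_convex_hull_nonempty)
  moreover have "x \<in> pos_hull (insert a S) \<longleftrightarrow>
      (\<exists>u\<in>convex_cone hull {a}. \<exists>w\<in>convex_cone hull S. x = u + w)"
    using convex_cone_hull_Un[of "{a}" S] by (auto simp: pos_hull_eq_convex_cone_hull)
  ultimately show ?thesis
    by (auto simp: pos_hull_eq_convex_cone_hull)
qed

lemma pos_hull_insert_scaleR:
  assumes "0 < c"
  shows "pos_hull (insert (c *\<^sub>R a) S) = pos_hull (insert a S)"
proof -
  have le: "pos_hull (insert (d *\<^sub>R b) S) \<subseteq> pos_hull (insert b S)" if "0 \<le> d" for d b
  proof
    fix x assume "x \<in> pos_hull (insert (d *\<^sub>R b) S)"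
    then obtain t w where "0 \<le> t" "w \<in> pos_hull S" "x = (t * d) *\<^sub>R b + w"
      by (auto simp: pos_hull_insert_iff)
    then show "x \<in> pos_hull (insert b S)"
      unfolding pos_hull_insert_iff using that by (intro exI[of _ "t * d"]) auto
  qed
  show ?thesis
    \<comment> \<open>The reverse inclusion is \<open>le\<close> again, for the vector
      \<open>c *\<^sub>R a\<close> scaled back by \<open>inverse c\<close>.\<close>
    using le[of c a] le[of "inverse c" "c *\<^sub>R a"] assms by simp
qed

text \<open>In t a - t' a + w the smaller coefficient cancels, and the sign of what is left tells
  which of the two cones contains the point.\<close>

lemma pos_hull_insert_neg_Un:
  "pos_hull (insert a S) \<union> pos_hull (insert (- a) S) = pos_hull (insert a (insert (- a) S))"
proof
  show "pos_hull (insert a S) \<union> pos_hull (insert (- a) S) \<subseteq> pos_hull (insert a (insert (- a) S))"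
    by (auto intro: subsetD[OF pos_hull_mono, rotated])
  show "pos_hull (insert a (insert (- a) S)) \<subseteq> pos_hull (insert a S) \<union> pos_hull (insert (- a) S)"
  proof
    fix x assume "x \<in> pos_hull (insert a (insert (- a) S))"
    then obtain t t' w where *: "0 \<le> t" "0 \<le> t'" "w \<in> pos_hull S" "x = t *\<^sub>R a + (t' *\<^sub>R (- a) + w)"
      by (auto simp: pos_hull_insert_iff)
    show "x \<in> pos_hull (insert a S) \<union> pos_hull (insert (- a) S)"
    proof (cases "t' \<le> t")
      case True
      with * have "x = (t - t') *\<^sub>R a + w" "0 \<le> t - t'" by (auto simp: algebra_simps)
      with * show ?thesis by (metis UnI1 pos_hull_insert_iff)
    next
      case False
      with * have "x = (t' - t) *\<^sub>R (- a) + w" "0 \<le> t' - t" by (auto simp: algebra_simps)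
      with * show ?thesis by (metis UnI2 pos_hull_insert_iff)
    qed
  qed
qed

text \<open>If x = t a + w = -t' a + w', then weighting the two expressions by t' and t cancels a
  and leaves (t + t') x = t' w + t w', an element of the cone. If t + t' = 0, then x = w
  already.\<close>

lemma pos_hull_insert_neg_Int:
  "pos_hull (insert a S) \<inter> pos_hull (insert (- a) S) = pos_hull S"
proof
  show "pos_hull S \<subseteq> pos_hull (insert a S) \<inter> pos_hull (insert (- a) S)"
    by (auto intro: subsetD[OF pos_hull_mono, rotated])
  show "pos_hull (insert a S) \<inter> pos_hull (insert (- a) S) \<subseteq> pos_hull S"
  proof
    fix x assume "x \<in> pos_hull (insert a S) \<inter> pos_hull (insert (- a) S)"
    then obtain t w t' w' where *: "0 \<le> t" "w \<in> pos_hull S" "x = t *\<^sub>R a + w"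
      "0 \<le> t'" "w' \<in> pos_hull S" "x = t' *\<^sub>R (- a) + w'"
      by (auto simp: pos_hull_insert_iff)
    show "x \<in> pos_hull S"
    proof (cases "t + t' = 0")
      case True
      then have "t = 0" using * by linarith
      with * show ?thesis by simp
    next
      case False
      have "(t + t') *\<^sub>R x = t' *\<^sub>R x + t *\<^sub>R x" by (simp add: algebra_simps)
      also have "\<dots> = t' *\<^sub>R (t *\<^sub>R a + w) + t *\<^sub>R (t' *\<^sub>R (- a) + w')"
        using *(3) *(6) by simp
      also have "\<dots> = t' *\<^sub>R w + t *\<^sub>R w'" by (simp add: algebra_simps)
      finally have "x = inverse (t + t') *\<^sub>R (t' *\<^sub>R w + t *\<^sub>R w')"
        using False by (metis left_inverse scaleR_one scaleR_scaleR)
      then show ?thesis using * by (auto intro!: pos_hull_scaleR pos_hull_add)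
    qed
  qed
qed

lemma contains_line_pos_hull:
  fixes v :: "'a::euclidean_space"
  assumes "v \<in> pos_hull S" "- v \<in> pos_hull S" "v \<noteq> 0"
  shows "contains_line (pos_hull S)"
  unfolding contains_line_def
proof (intro exI conjI)
  show "dim (span {v}) = 1"
    using assms(3) by (simp add: dim_eq_card_independent[of "{v}"])
  show "span {v} \<subseteq> pos_hull S"
  proof
    fix x assume "x \<in> span {v}"
    then obtain c where x: "x = c *\<^sub>R v" by (auto simp: span_singleton)
    show "x \<in> pos_hull S"
    proof (cases "0 \<le> c")
      case False
      then have "(- c) *\<^sub>R (- v) \<in> pos_hull S" using assms by (intro pos_hull_scaleR) auto
      then show ?thesis by (simp add: x)
    qed (use assms in \<open>auto simp: x intro: pos_hull_scaleR\<close>)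
  qed
qed auto

section \<open>Valuations vanishing on thin cones and on cones with lines\<close>

locale simple_cone_valuation =
  fixes \<mu> :: "'a::euclidean_space set \<Rightarrow> real"
  assumes val: "cone_valuation \<mu>"
    and zero: "\<And>D. polyhedral_cone D \<Longrightarrow> dim D < DIM('a) \<or> contains_line D \<Longrightarrow> \<mu> D = 0"
begin

text \<open>The two cones on the right have a union that contains the line through \<open>a\<close>,
  so only their intersection \<open>pos_hull S\<close> contributes.\<close>

lemma mu_pos_hull_split:
  assumes "finite S" "a \<noteq> 0"
  shows "\<mu> (pos_hull S) = \<mu> (pos_hull (insert a S)) + \<mu> (pos_hull (insert (- a) S))"
proof -
  have "\<mu> (pos_hull (insert a (insert (- a) S))) = 0"
    using assms by (intro zero polyhedral_cone_pos_hull disjI2 contains_line_pos_hull[of a])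
      (use pos_hull_superset[of "insert a (insert (- a) S)"] in auto)
  moreover have "\<mu> (pos_hull (insert a S) \<union> pos_hull (insert (- a) S)) +
     \<mu> (pos_hull (insert a S) \<inter> pos_hull (insert (- a) S)) =
     \<mu> (pos_hull (insert a S)) + \<mu> (pos_hull (insert (- a) S))"
    using val[unfolded cone_valuation_def, rule_format, of "pos_hull (insert a S)" "pos_hull (insert (- a) S)"]
      assms(1) by (simp add: pos_hull_insert_neg_Un)
  ultimately show ?thesis
    by (simp add: pos_hull_insert_neg_Un pos_hull_insert_neg_Int)
qed

lemma mu_pos_hull_lower_dim:
  assumes "finite S" "dim S < DIM('a)"
  shows "\<mu> (pos_hull S) = 0"
proof -
  have "dim (pos_hull S) \<le> dim S"
    using dim_subset[OF pos_hull_subset_span, of S] by (simp add: dim_span)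
  with assms show ?thesis by (intro zero) auto
qed

lemma mu_pos_hull_card_less: "finite S \<Longrightarrow> card S < DIM('a) \<Longrightarrow> \<mu> (pos_hull S) = 0"
  by (meson dim_le_card' le_less_trans mu_pos_hull_lower_dim)

lemma mu_pos_hull_neg:
  assumes "finite S" "\<mu> (pos_hull S) = 0" "a \<noteq> 0"
  shows "\<mu> (pos_hull (insert (- a) S)) = - \<mu> (pos_hull (insert a S))"
  using mu_pos_hull_split[OF assms(1,3)] assms(2) by simp

text \<open>A positive factor leaves the cone unchanged; a negative one acts like -1, which reverses
  the sign of the value by \<open>mu_pos_hull_neg\<close>.\<close>

lemma mu_pos_hull_insert_scaleR:
  assumes "finite S" "\<mu> (pos_hull S) = 0" "a \<noteq> 0" "c \<noteq> 0"
  shows "\<mu> (pos_hull (insert (c *\<^sub>R a) S)) = sgn c * \<mu> (pos_hull (insert a S))"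
proof (cases "0 < c")
  case True
  then show ?thesis by (simp add: pos_hull_insert_scaleR)
next
  case False
  then have "0 < - c" using assms by auto
  from pos_hull_insert_scaleR[OF this, of "- a" S] show ?thesis
    using False assms mu_pos_hull_neg[OF assms(1-3)] by (auto simp: sgn_if)
qed

text \<open>Split \<open>pos(p, p + q, S)\<close> by \<open>q\<close>: one half is \<open>pos(p, q, S)\<close>, the other is
  \<open>pos(p + q, -q, S)\<close> because \<open>p = (p + q) + (-q)\<close>.\<close>

lemma mu_pos_hull_dissect:
  assumes S: "finite S" and z: "p + q \<noteq> 0" and q: "q \<noteq> 0"
    and 0: "\<mu> (pos_hull (insert (p + q) S)) = 0"
  shows "\<mu> (pos_hull (insert p (insert q S))) =
    \<mu> (pos_hull (insert p (insert (p + q) S))) + \<mu> (pos_hull (insert (p + q) (insert q S)))"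
proof -
  let ?z = "p + q"
  have absorb: "pos_hull (insert (x + y) (insert x (insert y T))) = pos_hull (insert x (insert y T))"
    for x y :: 'a and T
    by (intro pos_hull_insert_absorb pos_hull_add) (auto intro: subsetD[OF pos_hull_superset])
  have "\<mu> (pos_hull (insert p (insert ?z S))) =
     \<mu> (pos_hull (insert q (insert p (insert ?z S)))) + \<mu> (pos_hull (insert (- q) (insert p (insert ?z S))))"
    by (rule mu_pos_hull_split) (use S q in auto)
  also have "insert q (insert p (insert ?z S)) = insert ?z (insert p (insert q S))" by auto
  also have "insert (- q) (insert p (insert ?z S)) = insert (?z + (- q)) (insert ?z (insert (- q) S))" by auto
  finally have "\<mu> (pos_hull (insert p (insert ?z S))) =
     \<mu> (pos_hull (insert p (insert q S))) + \<mu> (pos_hull (insert ?z (insert (- q) S)))"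
    unfolding absorb .
  \<comment> \<open>Reversing \<open>q\<close> changes the sign because the cone over
    \<open>z\<close> and \<open>S\<close> alone has value 0; this turns the difference into the sum
    claimed.\<close>
  also have "\<mu> (pos_hull (insert ?z (insert (- q) S))) = - \<mu> (pos_hull (insert ?z (insert q S)))"
    using mu_pos_hull_neg[of "insert ?z S" q] S q 0 by (simp add: insert_commute)
  finally show ?thesis by simp
qed

text \<open>Strong induction on the number of generators. It makes every proper subfamily
  negligible, so negating a generator preserves the absolute value of \<mu>; negating those with
  negative coefficient in a linear dependency creates a line.\<close>

lemma mu_eq_0_from_simplicial:
  assumes simp: "\<And>S. finite S \<Longrightarrow> independent S \<Longrightarrow> card S = DIM('a) \<Longrightarrow> \<mu> (pos_hull S) = 0"
    and "finite S"
  shows "\<mu> (pos_hull S) = 0"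
  using \<open>finite S\<close>
proof (induction "card S" arbitrary: S rule: less_induct)
  case (less S)
  consider "0 \<in> S" | "independent S" | "0 \<notin> S" "dependent S" by blast
  then show ?case
  proof cases
    case 1
    then have "pos_hull S = pos_hull (S - {0})"
      by (metis insert_Diff pos_hull_insert_absorb zero_in_pos_hull)
    moreover have "card (S - {0}) < card S" using 1 less.prems by (meson card_Diff1_less)
    ultimately show ?thesis using less by simp
  next
    case 2
    show ?thesis
      by (metis "2" dim_eq_card_independent dim_subset_UNIV le_neq_implies_less less.prems
          mu_pos_hull_lower_dim simp)
  next
    case 3
    then obtain c v where c: "(\<Sum>v\<in>S. c v *\<^sub>R v) = 0" "v \<in> S" "c v \<noteq> 0"
      using dependent_finite[OF less.prems] by blast
    \<comment> \<open>The generators in \<open>T\<close> are negated one at a time. Only absolute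
      values are tracked, so the number of sign changes does not matter.\<close>
    have flip: "\<bar>\<mu> (pos_hull (uminus ` T \<union> (S - T)))\<bar> = \<bar>\<mu> (pos_hull S)\<bar>" if "finite T" "T \<subseteq> S" for T
      using that
    proof (induction T rule: finite_induct)
      case (insert a T)
      \<comment> \<open>The generators common to the families before and after negating
        \<open>a\<close>. Negated vectors may coincide with others, so the cardinality is only
        bounded, which suffices for the induction hypothesis.\<close>
      let ?R = "uminus ` T \<union> (S - insert a T)"
      have fin: "finite T" "finite ?R" using less.prems insert by auto
      have "card ?R \<le> card T + card (S - insert a T)"
        using fin by (meson add_le_mono1 card_Un_le card_image_le order_trans)
      also have "\<dots> < card S"
      proof -
        have "card (insert a T) \<le> card S" using insert less.prems by (intro card_mono) auto
        then show ?thesis using insert fin(1) by (simp add: card_Diff_subset)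
      qed
      finally have "\<mu> (pos_hull ?R) = 0" using fin(2) by (rule less.hyps)
      moreover have "a \<noteq> 0" using insert 3 by auto
      ultimately have neg: "\<mu> (pos_hull (insert (- a) ?R)) = - \<mu> (pos_hull (insert a ?R))"
        by (intro mu_pos_hull_neg fin)
      have eq: "insert (- a) ?R = uminus ` insert a T \<union> (S - insert a T)"
        "insert a ?R = uminus ` T \<union> (S - T)" using insert by auto
      have "\<bar>\<mu> (pos_hull (uminus ` T \<union> (S - T)))\<bar> = \<bar>\<mu> (pos_hull S)\<bar>"
        using insert by simp
      then show ?case using neg unfolding eq by linarith
    qed simp
    define T where "T = {v\<in>S. c v < 0}"
    define s where "s v = (if c v < 0 then - v else v)" for v
    let ?P = "uminus ` T \<union> (S - T)"
    have sP: "s u \<in> pos_hull ?P" if "u \<in> S" for u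
      using that by (intro subsetD[OF pos_hull_superset]) (auto simp: s_def T_def)
    have sum0: "(\<Sum>u\<in>S. \<bar>c u\<bar> *\<^sub>R s u) = 0"
      unfolding c(1)[symmetric] by (intro sum.cong) (auto simp: s_def)
    \<comment> \<open>Since all coefficients are now nonnegative, the opposite of one term of the
      dependency is a nonnegative combination of the others.\<close>
    have "- (\<bar>c v\<bar> *\<^sub>R s v) = (\<Sum>u\<in>S - {v}. \<bar>c u\<bar> *\<^sub>R s u)"
      using sum0 c(2) less.prems by (simp add: sum.remove[of S v] eq_neg_iff_add_eq_0 neg_eq_iff_add_eq_0)
    moreover have "(\<Sum>u\<in>S - {v}. \<bar>c u\<bar> *\<^sub>R s u) \<in> pos_hull ?P"
      by (intro pos_hull_sum pos_hull_scaleR sP) auto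
    ultimately have "contains_line (pos_hull ?P)"
      using c 3 by (intro contains_line_pos_hull[of "\<bar>c v\<bar> *\<^sub>R s v"] pos_hull_scaleR sP)
        (auto simp: s_def)
    then have "\<mu> (pos_hull ?P) = 0"
      using less.prems by (intro zero polyhedral_cone_pos_hull) (auto simp: T_def)
    then show ?thesis using flip[of T] less.prems by (auto simp: T_def)
  qed
qed

end

subsection \<open>The signed value as a cocycle\<close>

text \<open>Multilinearity leaves two determinants, and the one with coefficient \<beta> has equal
  rows \<open>i\<close> and \<open>m\<close>.\<close>

lemma det_upd_row_lincomb:
  fixes y :: "'n::finite \<Rightarrow> real ^ 'n"
  assumes "i \<noteq> m"
  shows "det (\<chi> j. (y(i := \<alpha> *\<^sub>R y i + \<beta> *\<^sub>R y m)) j) = \<alpha> * det (\<chi> j. y j)"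
proof -
  let ?r = "\<lambda>v. (\<chi> j. if j = i then v else y j) :: real ^ 'n ^ 'n"
  have "det (?r (\<alpha> *\<^sub>R y i + \<beta> *\<^sub>R y m)) = \<alpha> * det (?r (y i)) + \<beta> * det (?r (y m))"
    using det_row_add[of i "\<lambda>_. \<alpha> *\<^sub>R y i" "\<lambda>_. \<beta> *\<^sub>R y m" y]
      det_row_mul[of i \<alpha> "\<lambda>_. y i" y] det_row_mul[of i \<beta> "\<lambda>_. y m" y]
    unfolding scalar_mult_eq_scaleR by simp
  also have "det (?r (y m)) = 0"
    using assms by (intro det_identical_rows[of i m]) (auto simp: row_def vec_eq_iff)
  also have "?r (y i) = (\<chi> j. y j)" by (auto simp: vec_eq_iff)
  finally show ?thesis by (simp add: fun_upd_apply)
qed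

locale invariant_simple_cone_valuation = simple_cone_valuation \<mu>
  for \<mu> :: "(real ^ 'n::{finite,wellorder}) set \<Rightarrow> real" +
  assumes orth_inv: "orthogonally_invariant \<mu>"
begin

text \<open>The orientation sign compensates the sign change of \<mu> when a generator is negated.
  It also makes the value 0 on dependent families before anything is known about \<mu>
  there.\<close>

definition signed_value :: "('n \<Rightarrow> real ^ 'n::_) \<Rightarrow> real" where
  "signed_value y = sgn (det (\<chi> i. y i)) * \<mu> (pos_hull (range y))"

lemma signed_value_scaleR:
  assumes "c \<noteq> 0" "y m \<noteq> 0"
  shows "signed_value (y(m := c *\<^sub>R y m)) = signed_value y"
proof -
  define R where "R = y ` (- {m})"
  have "card R \<le> card (- {m})" unfolding R_def by (rule card_image_le) simp
  also have "\<dots> < CARD('n)" by (simp add: Compl_eq_Diff_UNIV card_Diff_subset)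
  finally have "\<mu> (pos_hull R) = 0" by (intro mu_pos_hull_card_less) (auto simp: R_def)
  then have "\<mu> (pos_hull (insert (c *\<^sub>R y m) R)) = sgn c * \<mu> (pos_hull (insert (y m) R))"
    using assms by (intro mu_pos_hull_insert_scaleR) (auto simp: R_def)
  moreover have "range y = insert (y m) R" "range (y(m := c *\<^sub>R y m)) = insert (c *\<^sub>R y m) R"
    by (auto simp: R_def image_iff)
  moreover have "det (\<chi> j. (y(m := c *\<^sub>R y m)) j) = c * det (\<chi> j. y j)"
  proof -
    have "(\<chi> j. if j = m then y m else y j) = (\<chi> j. y j)" by (auto simp: vec_eq_iff)
    then show ?thesis
      using det_row_mul[of m c "\<lambda>_. y m" y] unfolding scalar_mult_eq_scaleR by (simp add: fun_upd_apply)
  qed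
  ultimately show ?thesis
    using assms by (simp add: signed_value_def sgn_mult)
qed

text \<open>The two-vector case of the cocycle relation. The replacements multiply the determinant
  by \<alpha> and \<beta>; for nonzero coefficients the relation is
  \<open>mu_pos_hull_dissect\<close> for the scaled vectors, with the signs of \<alpha> and \<beta>
  moved into the determinants. If one coefficient vanishes, so does the corresponding
  summand.\<close>

lemma signed_value_chasles:
  fixes y :: "'n \<Rightarrow> real ^ 'n::_"
  assumes im: "i \<noteq> m" and z: "z = \<alpha> *\<^sub>R y i + \<beta> *\<^sub>R y m" "z \<noteq> 0"
  shows "signed_value y = signed_value (y(i := z)) + signed_value (y(m := z))"
proof -
  define D where "D = det (\<chi> j. y j)"
  define R where "R = y ` (- {i, m})"
  have finR: "finite R" by (simp add: R_def)
  have det_i: "det (\<chi> j. (y(i := z)) j) = \<alpha> * D"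
    unfolding z D_def by (rule det_upd_row_lincomb[OF im])
  have det_m: "det (\<chi> j. (y(m := z)) j) = \<beta> * D"
    unfolding z D_def using det_upd_row_lincomb[of m i y \<beta> \<alpha>] im by (simp add: add.commute)
  have rng: "range y = insert (y i) (insert (y m) R)"
    "range (y(i := z)) = insert z (insert (y m) R)"
    "range (y(m := z)) = insert (y i) (insert z R)"
    using im by (auto simp: R_def image_iff)
  have sv: "signed_value y = sgn D * \<mu> (pos_hull (insert (y i) (insert (y m) R)))"
    "signed_value (y(i := z)) = sgn \<alpha> * sgn D * \<mu> (pos_hull (insert z (insert (y m) R)))"
    "signed_value (y(m := z)) = sgn \<beta> * sgn D * \<mu> (pos_hull (insert (y i) (insert z R)))"
    unfolding signed_value_def det_i det_m rng by (simp_all add: D_def sgn_mult)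
  \<comment> \<open>For D = 0 all three determinants vanish. Otherwise no generator is 0, so each
    may be rescaled.\<close>
  show ?thesis
  proof (cases "D = 0")
    case False
    have nz: "y j \<noteq> 0" for j
    proof
      assume "y j = 0"
      then have "row j (\<chi> j. y j) = 0" by (simp add: row_def vec_eq_iff)
      with False show False unfolding D_def by (metis det_zero_row(2))
    qed
    \<comment> \<open>\<open>R\<close> comes from n - 2 indices, so one further vector still leaves
      fewer than n generators.\<close>
    have small: "\<mu> (pos_hull (insert v R)) = 0" for v
    proof (rule mu_pos_hull_card_less)
      have "card R \<le> card (- {i, m})" unfolding R_def by (rule card_image_le) simp
      also have "\<dots> = CARD('n) - 2" using im by (simp add: Compl_eq_Diff_UNIV card_Diff_subset)
      finally have "card (insert v R) \<le> Suc (CARD('n) - 2)"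
        by (metis card_insert_le_m1 diff_Suc_1 le_SucI order_trans zero_less_Suc Suc_le_mono card_insert_if finR)
      moreover have "card {i, m} \<le> CARD('n)" by (intro card_mono) auto
      then have "2 \<le> CARD('n)" using im by simp
      ultimately show "card (insert v R) < DIM(real ^ 'n::_)" by simp
    qed (simp add: finR)
    have scale: "\<mu> (pos_hull (insert (c *\<^sub>R u) (insert v R))) = sgn c * \<mu> (pos_hull (insert u (insert v R)))"
      if "c \<noteq> 0" "u \<noteq> 0" for c u v
      using that by (intro mu_pos_hull_insert_scaleR small) (simp_all add: finR)
    have sgn2: "sgn c * (sgn c * t) = t" if "c \<noteq> 0" for c t :: real
      using that by (auto simp: sgn_if)
    have "\<alpha> \<noteq> 0 \<or> \<beta> \<noteq> 0" using z by auto
    then consider "\<alpha> = 0" "\<beta> \<noteq> 0" | "\<beta> = 0" "\<alpha> \<noteq> 0" | "\<alpha> \<noteq> 0" "\<beta> \<noteq> 0" by blast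
    then show ?thesis
    proof cases
      case 1
      then have "\<mu> (pos_hull (insert (y i) (insert z R))) = sgn \<beta> * \<mu> (pos_hull (insert (y i) (insert (y m) R)))"
        using scale[OF _ nz, of \<beta> m "y i"] by (simp add: z insert_commute)
      then show ?thesis unfolding sv using 1 sgn2[of \<beta>] by (simp add: ac_simps)
    next
      case 2
      then have "\<mu> (pos_hull (insert z (insert (y m) R))) = sgn \<alpha> * \<mu> (pos_hull (insert (y i) (insert (y m) R)))"
        using scale[OF _ nz, of \<alpha> i "y m"] by (simp add: z)
      then show ?thesis unfolding sv using 2 sgn2[of \<alpha>] by (simp add: ac_simps)
    next
      case 3
      let ?p = "\<alpha> *\<^sub>R y i" and ?q = "\<beta> *\<^sub>R y m"
      have "\<mu> (pos_hull (insert ?p (insert ?q R))) =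
          \<mu> (pos_hull (insert ?p (insert z R))) + \<mu> (pos_hull (insert z (insert ?q R)))"
        using mu_pos_hull_dissect[of R ?p ?q] 3 nz z finR small by simp
      moreover have "\<mu> (pos_hull (insert ?p (insert ?q R))) =
          sgn \<alpha> * (sgn \<beta> * \<mu> (pos_hull (insert (y i) (insert (y m) R))))"
        using scale[OF _ nz, of \<alpha> i ?q] scale[OF _ nz, of \<beta> m "y i"] 3 by (simp add: insert_commute)
      moreover have "\<mu> (pos_hull (insert ?p (insert z R))) = sgn \<alpha> * \<mu> (pos_hull (insert (y i) (insert z R)))"
        using scale[OF _ nz, of \<alpha> i z] 3 by simp
      moreover have "\<mu> (pos_hull (insert z (insert ?q R))) = sgn \<beta> * \<mu> (pos_hull (insert z (insert (y m) R)))"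
        using scale[OF _ nz, of \<beta> m z] 3 by (simp add: insert_commute)
      ultimately show ?thesis
        unfolding sv using 3 by (auto simp: sgn_if algebra_simps split: if_splits)
    qed
  qed (simp add: sv)
qed

lemma signed_value_dependent:
  assumes "\<not> (inj_on y I \<and> independent (y ` I))"
  shows "signed_value y = 0"
proof -
  have r: "row i (\<chi> i. y i) = y i" for i by (simp add: row_def vec_eq_iff)
  have "det (\<chi> i. y i) = 0"
  proof (cases "inj_on y I")
    case True
    then have "dependent (rows (\<chi> i. y i))"
      using assms by (auto simp: rows_def r full_SetCompr_eq intro: dependent_mono[of "y ` I"])
    then show ?thesis by (intro det_dependent_rows) (simp add: dependent_vec_eq)
  next
    case False
    then obtain i j where "i \<noteq> j" "y i = y j" by (auto simp: inj_on_def)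
    then show ?thesis by (intro det_identical_rows[of i j]) (auto simp: r)
  qed
  then show ?thesis by (simp add: signed_value_def)
qed

text \<open>Induction on \<open>I\<close>: write z = w + \<alpha> y_m with w in the span of the
  other vectors. Expand by the induction hypothesis for w, exchange w for z in each term by
  \<open>signed_value_chasles\<close>, and recognise the remaining terms as the expansion of
  \<open>y(m := z)\<close> along w.\<close>

lemma signed_value_cocycle:
  fixes y :: "'n \<Rightarrow> real ^ 'n::_"
  assumes "z \<in> span (y ` I)" "z \<noteq> 0"
  shows "signed_value y = (\<Sum>i\<in>I. signed_value (y(i := z)))"
proof -
  have "finite I" by simp
  then show ?thesis using assms
  proof (induction I arbitrary: y z rule: finite_induct)
    case (insert m I)
    obtain \<alpha> where "z - \<alpha> *\<^sub>R y m \<in> span (y ` I)"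
      using insert.prems(1) span_breakdown_eq[of z "y m" "y ` I"] by auto
    define w where "w = z - \<alpha> *\<^sub>R y m"
    have w: "w \<in> span (y ` I)" and z: "z = w + \<alpha> *\<^sub>R y m"
      unfolding w_def by fact simp
    show ?case
    proof (cases "w = 0")
      \<comment> \<open>Here \<open>z\<close> is a multiple of \<open>y m\<close>. Replacing any
        other vector by it gives a dependent family, so only the term for \<open>m\<close>
        survives.\<close>
      case True
      then have z: "z = \<alpha> *\<^sub>R y m" "\<alpha> \<noteq> 0" "y m \<noteq> 0" using z insert.prems(2) by auto
      have 0: "signed_value (y(i := z)) = 0" if "i \<in> I" for i
      proof (rule signed_value_dependent[of _ "{i, m}"])
        have im: "i \<noteq> m" using that insert.hyps by auto
        show "\<not> (inj_on (y(i := z)) {i, m} \<and> independent ((y(i := z)) ` {i, m}))"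
        proof (cases "z = y m")
          case False
          have "dependent {z, y m}"
            unfolding dependent_def using False z
            by (intro bexI[of _ z]) (auto simp: span_singleton insert_Diff_if)
          then show ?thesis using im by (auto simp: insert_commute)
        qed (use im in \<open>auto simp: inj_on_def\<close>)
      qed
      have "signed_value (y(m := z)) = signed_value y"
        unfolding z(1) by (rule signed_value_scaleR[where y = y and m = m, OF z(2,3)])
      moreover have "(\<Sum>i\<in>I. signed_value (y(i := z))) = 0"
        using 0 by (rule sum.neutral[OF ballI])
      ultimately show ?thesis by (metis add.right_neutral insert.hyps sum.insert)
    next
      case False
      have "signed_value y = (\<Sum>i\<in>I. signed_value (y(i := w)))"
        by (rule insert.IH[OF w False])
      also have "\<dots> = (\<Sum>i\<in>I. signed_value (y(i := z)) + signed_value (y(m := z, i := w)))"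
      proof (rule sum.cong[OF refl])
        fix i assume "i \<in> I"
        then have im: "i \<noteq> m" using insert.hyps by auto
        show "signed_value (y(i := w)) = signed_value (y(i := z)) + signed_value (y(m := z, i := w))"
          using signed_value_chasles[of i m z 1 "y(i := w)" \<alpha>] im insert.prems(2)
          by (simp add: z fun_upd_twist)
      qed
      also have "\<dots> = (\<Sum>i\<in>I. signed_value (y(i := z))) + (\<Sum>i\<in>I. signed_value (y(m := z, i := w)))"
        by (rule sum.distrib)
      also have "(\<Sum>i\<in>I. signed_value (y(m := z, i := w))) = signed_value (y(m := z))"
      proof (rule insert.IH[OF _ False, symmetric])
        have "(y(m := z)) ` I = y ` I" using insert.hyps by (intro image_cong) auto
        then show "w \<in> span ((y(m := z)) ` I)" using w by simp
      qed
      finally show ?thesis by (metis add.commute insert.hyps sum.insert)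
    qed
  qed simp
qed

text \<open>The value of \<mu> is invariant, while the rows are multiplied on the right by an
  orthogonal matrix. For a reflection this is the oddness behind the averaging argument.\<close>

lemma signed_value_orthogonal:
  assumes g: "orthogonal_transformation g"
  shows "signed_value (\<lambda>i. g (y i)) = det (matrix g) * signed_value y"
proof -
  have lin: "linear g" using g by (rule orthogonal_transformation_linear)
  have "(\<chi> i. g (y i)) = (\<chi> i. y i) ** transpose (matrix g)"
  proof -
    have "g (y i) $ j = (\<Sum>k\<in>UNIV. y i $ k * matrix g $ j $ k)" for i j
      using fun_cong[OF matrix_vector_mul(2)[OF lin], of "y i", symmetric]
      by (simp add: matrix_vector_mult_def mult.commute)
    then show ?thesis by (simp add: vec_eq_iff matrix_matrix_mult_def transpose_def)
  qed
  then have "det (\<chi> i. g (y i)) = det (\<chi> i. y i) * det (matrix g)"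
    by (simp add: det_mul)
  moreover have "det (matrix g) = 1 \<or> det (matrix g) = - 1"
    using g by (intro det_orthogonal_matrix) (simp add: orthogonal_transformation_matrix)
  moreover have "\<mu> (pos_hull (range (\<lambda>i. g (y i)))) = \<mu> (pos_hull (range y))"
  proof -
    have "range (\<lambda>i. g (y i)) = g ` range y" by auto
    then show ?thesis
      using orth_inv g by (simp add: pos_hull_linear_image[OF lin] orthogonally_invariant_def)
  qed
  ultimately show ?thesis
    by (auto simp: signed_value_def sgn_mult sgn_minus)
qed

end

subsection \<open>The uniform measure on the sphere\<close>

lemma uniform_sphere_measure_sets:
  "uniform_sphere_measure \<sigma> \<Longrightarrow> sets \<sigma> = sets (restrict_space borel (sphere 0 1))"
  by (simp add: uniform_sphere_measure_def)

lemma uniform_sphere_measure_space: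
  assumes "uniform_sphere_measure \<sigma>"
  shows "space \<sigma> = sphere 0 1"
  using sets_eq_imp_space_eq[OF uniform_sphere_measure_sets[OF assms]]
  by (simp add: space_restrict_space)

lemma borel_measurable_uniform_sphere_measure:
  assumes "uniform_sphere_measure \<sigma>" "f \<in> borel_measurable borel"
  shows "f \<in> borel_measurable \<sigma>"
  unfolding measurable_cong_sets[OF uniform_sphere_measure_sets[OF assms(1)] refl]
  using assms(2) by (rule measurable_restrict_space1)

lemma orthogonal_transformation_measurable:
  assumes "uniform_sphere_measure \<sigma>" "orthogonal_transformation g"
  shows "g \<in> measurable \<sigma> \<sigma>"
proof -
  have "linear g" using assms(2) by (rule orthogonal_transformation_linear)
  then have "g \<in> borel_measurable borel"
    by (intro borel_measurable_continuous_onI linear_continuous_on) (simp add: linear_conv_bounded_linear)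
  then have "g \<in> measurable (restrict_space borel (sphere 0 1)) (restrict_space borel (sphere 0 1))"
    using assms(2) by (intro measurable_restrict_space3) (auto simp: orthogonal_transformation_norm)
  then show ?thesis
    unfolding measurable_cong_sets[OF uniform_sphere_measure_sets uniform_sphere_measure_sets, OF assms(1) assms(1)] .
qed

text \<open>The measure is invariant under images whereas a push-forward takes preimages, so
  invariance is applied to the inverse of \<open>g\<close>.\<close>

lemma orthogonal_transformation_distr:
  assumes \<sigma>: "uniform_sphere_measure \<sigma>" and g: "orthogonal_transformation g"
  shows "distr \<sigma> \<sigma> g = \<sigma>"
proof (rule measure_eqI)
  fix A assume "A \<in> sets (distr \<sigma> \<sigma> g)"
  then have A: "A \<in> sets \<sigma>" by simp
  have sp: "space \<sigma> = sphere 0 1" by (rule uniform_sphere_measure_space[OF \<sigma>])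
  have AS: "A \<subseteq> sphere 0 1" using sets.sets_into_space[OF A] unfolding sp .
  have "g -` A \<subseteq> space \<sigma>"
  proof
    fix x assume "x \<in> g -` A"
    then have "norm (g x) = 1" using AS by auto
    then show "x \<in> space \<sigma>" by (simp add: sp orthogonal_transformation_norm[OF g])
  qed
  then have "g -` A \<inter> space \<sigma> = inv g ` A"
    by (metis Int_absorb2 bij_vimage_eq_inv_image g orthogonal_transformation_bij)
  then have "emeasure (distr \<sigma> \<sigma> g) A = emeasure \<sigma> (inv g ` A)"
    using A orthogonal_transformation_measurable[OF \<sigma> g] by (simp add: emeasure_distr)
  also have "\<dots> = emeasure \<sigma> A"
    using \<sigma> A orthogonal_transformation_inv[OF g] by (simp add: uniform_sphere_measure_def)
  finally show "emeasure (distr \<sigma> \<sigma> g) A = emeasure \<sigma> A" .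
qed simp

lemma AE_orthogonal_transformation:
  assumes "uniform_sphere_measure \<sigma>" "orthogonal_transformation g" "AE x in \<sigma>. P x"
  shows "AE x in \<sigma>. P (g x)"
  using AE_distrD[OF orthogonal_transformation_measurable[OF assms(1,2)], of P]
  unfolding orthogonal_transformation_distr[OF assms(1,2)] using assms(3) by blast

lemma integrable_orthogonal_transformation:
  fixes f :: "_ \<Rightarrow> real"
  assumes "uniform_sphere_measure \<sigma>" "orthogonal_transformation g" "integrable \<sigma> f"
  shows "integrable \<sigma> (\<lambda>x. f (g x))"
  by (rule integrable_distr[OF orthogonal_transformation_measurable[OF assms(1,2)]])
     (simp add: orthogonal_transformation_distr[OF assms(1,2)] assms(3))

lemma integral_orthogonal_transformation:
  fixes f :: "_ \<Rightarrow> real"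
  assumes "uniform_sphere_measure \<sigma>" "orthogonal_transformation g" "f \<in> borel_measurable \<sigma>"
  shows "(\<integral>x. f (g x) \<partial>\<sigma>) = (\<integral>x. f x \<partial>\<sigma>)"
  using integral_distr[OF orthogonal_transformation_measurable[OF assms(1,2)] assms(3)]
  by (simp add: orthogonal_transformation_distr[OF assms(1,2)])

lemma emeasure_space_uniform_sphere_measure: "uniform_sphere_measure \<sigma> \<Longrightarrow> emeasure \<sigma> (space \<sigma>) = 1"
  by (simp add: uniform_sphere_measure_space) (simp add: uniform_sphere_measure_def)

text \<open>Great subspheres are null sets. For fixed x on the sphere, almost no u is orthogonal to
  x; exchanging the quantifiers by Fubini produces one good u, and rotating the direction of b to
  that of u transfers the conclusion to b.\<close>

lemma AE_inner_neq_0: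
  fixes b :: "real ^ 'n"
  assumes \<sigma>: "uniform_sphere_measure \<sigma>" and b: "b \<noteq> 0"
  shows "AE x in \<sigma>. x \<bullet> b \<noteq> 0"
proof -
  interpret \<sigma>: finite_measure \<sigma>
    by standard (simp add: emeasure_space_uniform_sphere_measure[OF \<sigma>])
  interpret pair_sigma_finite \<sigma> "lborel :: (real ^ 'n) measure" ..
  have "AE x in \<sigma>. AE u in lborel. x \<bullet> u \<noteq> 0"
  proof (rule AE_I2)
    fix x assume "x \<in> space \<sigma>"
    then have "x \<noteq> 0" by (auto simp: uniform_sphere_measure_space[OF \<sigma>])
    then have "{u. x \<bullet> u = 0} \<in> null_sets lebesgue"
      using negligible_hyperplane[of x 0] by (simp add: negligible_iff_null_sets)
    then have "AE u in lebesgue. x \<bullet> u \<noteq> 0"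
      by (rule AE_I') auto
    then show "AE u in lborel. x \<bullet> u \<noteq> 0"
      by (simp add: AE_completion_iff)
  qed
  moreover have "{p \<in> space (\<sigma> \<Otimes>\<^sub>M lborel). fst p \<bullet> (snd p :: real ^ 'n) \<noteq> 0} \<in> sets (\<sigma> \<Otimes>\<^sub>M lborel)"
  proof -
    have [measurable]: "(\<lambda>x. x) \<in> borel_measurable \<sigma>"
      using \<sigma> by (rule borel_measurable_uniform_sphere_measure) simp
    have [measurable]: "fst \<in> borel_measurable (\<sigma> \<Otimes>\<^sub>M (lborel :: (real ^ 'n) measure))"
      using measurable_compose[OF measurable_fst \<open>(\<lambda>x. x) \<in> borel_measurable \<sigma>\<close>] by simp
    have [measurable]: "snd \<in> borel_measurable (\<sigma> \<Otimes>\<^sub>M (lborel :: (real ^ 'n) measure))"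
      using measurable_snd[of \<sigma> "lborel :: (real ^ 'n) measure"] by simp
    show ?thesis by measurable
  qed
  ultimately have "AE u in lborel. AE x in \<sigma>. x \<bullet> (u :: real ^ 'n) \<noteq> 0"
    using AE_commute[of "\<lambda>x u. x \<bullet> u \<noteq> 0"] by blast
  moreover have "AE u in lborel. u \<noteq> (0 :: real ^ 'n)"
    by (rule AE_lborel_singleton)
  ultimately have "AE u in lborel. u \<noteq> 0 \<and> (AE x in \<sigma>. x \<bullet> (u :: real ^ 'n) \<noteq> 0)"
    by eventually_elim simp
  \<comment> \<open>The almost-everywhere filter is proper, so a property holding almost everywhere
    has a witness.\<close>
  moreover have "ae_filter (lborel :: (real ^ 'n) measure) \<noteq> bot"
    by (simp add: ae_filter_eq_bot_iff)
  ultimately obtain u :: "real ^ 'n" where u: "u \<noteq> 0" "AE x in \<sigma>. x \<bullet> u \<noteq> 0"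
    using eventually_happens' by blast
  have "norm (b /\<^sub>R norm b) = norm (u /\<^sub>R norm u)" using u(1) b by simp
  then obtain g where g: "orthogonal_transformation g" "g (b /\<^sub>R norm b) = u /\<^sub>R norm u"
    by (rule orthogonal_transformation_exists)
  have "x \<bullet> b = (norm b / norm u) * (g x \<bullet> u)" for x
  proof -
    have "x \<bullet> (b /\<^sub>R norm b) = g x \<bullet> (u /\<^sub>R norm u)"
      using g by (metis orthogonal_transformation_def)
    then show ?thesis using b u(1) by (simp add: field_simps)
  qed
  with b u(1) AE_orthogonal_transformation[OF \<sigma> g(1) u(2)] show ?thesis
    by simp
qed

text \<open>The a.e. equality lets a function that is measurable only for the completion of the
  measure be integrated.\<close>

definition vanishing_mean :: "'a measure \<Rightarrow> ('a \<Rightarrow> real) \<Rightarrow> bool" where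
  "vanishing_mean M F \<longleftrightarrow> (\<exists>f. integrable M f \<and> (\<integral>x. f x \<partial>M) = 0 \<and> (AE x in M. F x = f x))"

lemma vanishing_mean_0 [simp]: "vanishing_mean M (\<lambda>_. 0)"
  unfolding vanishing_mean_def by (intro exI[of _ "\<lambda>_. 0"]) simp

lemma vanishing_mean_cong_AE:
  assumes "vanishing_mean M G" "AE x in M. F x = G x"
  shows "vanishing_mean M F"
proof -
  obtain f where f: "integrable M f" "(\<integral>x. f x \<partial>M) = 0" "AE x in M. G x = f x"
    using assms(1) by (auto simp: vanishing_mean_def)
  from assms(2) f(3) have "AE x in M. F x = f x" by eventually_elim simp
  with f show ?thesis by (auto simp: vanishing_mean_def)
qed

lemma vanishing_mean_sum:
  assumes "finite I" "\<And>i. i \<in> I \<Longrightarrow> vanishing_mean M (F i)"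
  shows "vanishing_mean M (\<lambda>x. \<Sum>i\<in>I. F i x)"
proof -
  have "\<forall>i\<in>I. \<exists>f. integrable M f \<and> (\<integral>x. f x \<partial>M) = 0 \<and> (AE x in M. F i x = f x)"
    using assms(2) by (simp add: vanishing_mean_def)
  then obtain f where f: "\<And>i. i \<in> I \<Longrightarrow> integrable M (f i)" "\<And>i. i \<in> I \<Longrightarrow> (\<integral>x. f i x \<partial>M) = 0"
    "\<And>i. i \<in> I \<Longrightarrow> AE x in M. F i x = f i x"
    by metis
  have "AE x in M. \<forall>i\<in>I. F i x = f i x"
    using f(3) assms(1) by (intro AE_finite_allI) auto
  then have "AE x in M. (\<Sum>i\<in>I. F i x) = (\<Sum>i\<in>I. f i x)"
    by eventually_elim simp
  with f(1,2) show ?thesis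
    unfolding vanishing_mean_def by (intro exI[of _ "\<lambda>x. \<Sum>i\<in>I. f i x"]) simp
qed

lemma vanishing_mean_const:
  assumes "vanishing_mean M (\<lambda>_. c)" "emeasure M (space M) = 1"
  shows "c = 0"
proof -
  obtain f where f: "integrable M f" "(\<integral>x. f x \<partial>M) = 0" "AE x in M. c = f x"
    using assms(1) by (auto simp: vanishing_mean_def)
  have "(\<integral>x. c \<partial>M) = (\<integral>x. f x \<partial>M)"
    using f by (intro integral_cong_AE) auto
  then show ?thesis using f(2) assms(2) by (simp add: measure_def)
qed

subsection \<open>Orthonormal families and orthoschemes\<close>

text \<open>Frames are indexed by natural numbers, with only the entries below n constrained, so
  that initial and final segments of a frame are easy to name.\<close>

definition orthonormal_family :: "(nat \<Rightarrow> real ^ 'n) \<Rightarrow> bool" where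
  "orthonormal_family b \<longleftrightarrow> (\<forall>l<CARD('n). \<forall>k<CARD('n). b l \<bullet> b k = (if l = k then 1 else 0))"

lemma orthonormal_familyD:
  fixes b :: "nat \<Rightarrow> real ^ 'n"
  shows "orthonormal_family b \<Longrightarrow> l < CARD('n) \<Longrightarrow> k < CARD('n) \<Longrightarrow> b l \<bullet> b k = (if l = k then 1 else 0)"
  by (simp add: orthonormal_family_def)

lemma orthonormal_family_expand:
  fixes b :: "nat \<Rightarrow> real ^ 'n"
  assumes b: "orthonormal_family b"
  shows "(\<Sum>l<CARD('n). (x \<bullet> b l) *\<^sub>R b l) = x"
proof -
  let ?B = "b ` {..<CARD('n)}"
  have inj: "inj_on b {..<CARD('n)}"
  proof (rule inj_onI)
    fix l k assume *: "l \<in> {..<CARD('n)}" "k \<in> {..<CARD('n)}" "b l = b k"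
    then have "b l \<bullet> b k = 1" using orthonormal_familyD[OF b, of l l] by simp
    then show "l = k" using orthonormal_familyD[OF b, of l k] * by (simp split: if_splits)
  qed
  have orth: "pairwise orthogonal ?B"
    using b by (auto simp: pairwise_def orthogonal_def orthonormal_family_def)
  have norm1: "norm v = 1" if "v \<in> ?B" for v
    using that b by (auto simp: orthonormal_family_def norm_eq_1)
  have "0 \<notin> ?B" using norm1 by force
  then have "independent ?B" using orth by (rule pairwise_orthogonal_independent[rotated])
  then have "span ?B = UNIV"
    using inj by (metis DIM_cart DIM_real card_image card_lessThan dim_eq_card_independent dim_eq_full mult.right_neutral)
  then have "(\<Sum>v\<in>?B. (x \<bullet> v) *\<^sub>R v) = x"
    using orth norm1 by (intro orthonormal_basis_expand) auto
  then show ?thesis by (simp add: sum.reindex[OF inj])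
qed

lemma orthonormal_family_inner:
  fixes b :: "nat \<Rightarrow> real ^ 'n"
  assumes b: "orthonormal_family b"
  shows "(\<Sum>l<CARD('n). (x \<bullet> b l) * (y \<bullet> b l)) = x \<bullet> y"
proof -
  have "x \<bullet> y = (\<Sum>l<CARD('n). (x \<bullet> b l) *\<^sub>R b l) \<bullet> y"
    by (simp only: orthonormal_family_expand[OF b])
  also have "\<dots> = (\<Sum>l<CARD('n). (x \<bullet> b l) * (y \<bullet> b l))"
    by (simp add: inner_sum_left inner_commute[of y])
  finally show ?thesis ..
qed

lemma orthonormal_family_image:
  fixes b :: "nat \<Rightarrow> real ^ 'n" and g :: "real ^ 'n \<Rightarrow> real ^ 'n"
  assumes "orthonormal_family b" "orthogonal_transformation g"
  shows "orthonormal_family (\<lambda>l. g (b l))"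
  using assms by (simp add: orthonormal_family_def orthogonal_transformation_def)

text \<open>The orthogonal projection to the span of \<open>b 0, \<dots>, b j\<close>, written so that it visibly depends only
  on the remaining vectors.\<close>

definition partial_proj :: "(nat \<Rightarrow> real ^ 'n) \<Rightarrow> nat \<Rightarrow> real ^ 'n \<Rightarrow> real ^ 'n" where
  "partial_proj b j v = v - (\<Sum>l\<in>{j<..<CARD('n)}. (v \<bullet> b l) *\<^sub>R b l)"

lemma partial_proj_inner:
  fixes b :: "nat \<Rightarrow> real ^ 'n"
  assumes b: "orthonormal_family b" and l: "l < CARD('n)"
  shows "partial_proj b j v \<bullet> b l = (if l \<le> j then v \<bullet> b l else 0)"
proof -
  have "(\<Sum>k\<in>{j<..<CARD('n)}. (v \<bullet> b k) *\<^sub>R b k) \<bullet> b l = (\<Sum>k\<in>{j<..<CARD('n)}. if k = l then v \<bullet> b l else 0)"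
    unfolding inner_sum_left using l by (intro sum.cong) (auto simp: orthonormal_familyD[OF b])
  also have "\<dots> = (if j < l then v \<bullet> b l else 0)" using l by simp
  finally show ?thesis by (simp add: partial_proj_def inner_diff_left)
qed

lemma partial_proj_cong:
  fixes b b' :: "nat \<Rightarrow> real ^ 'n"
  shows "(\<And>l. j < l \<Longrightarrow> l < CARD('n) \<Longrightarrow> b l = b' l) \<Longrightarrow> partial_proj b j v = partial_proj b' j v"
  by (simp add: partial_proj_def)

text \<open>The vectors in \<open>A\<close> and the later frame vectors number at most n - 1, so a
  unit vector c is orthogonal to all of them. The reflection exchanging b_k and c fixes the later
  frame vectors, being orthogonal to both.\<close>

lemma orthonormal_family_replace:
  fixes b :: "nat \<Rightarrow> real ^ 'n"
  assumes b: "orthonormal_family b" and k: "k < CARD('n)"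
    and A: "finite A" "card A \<le> k" "\<And>a l. a \<in> A \<Longrightarrow> k < l \<Longrightarrow> l < CARD('n) \<Longrightarrow> a \<bullet> b l = 0"
  shows "\<exists>b'. orthonormal_family b' \<and> (\<forall>l. k < l \<longrightarrow> l < CARD('n) \<longrightarrow> b' l = b l) \<and> (\<forall>a\<in>A. a \<bullet> b' k = 0)"
proof -
  let ?T = "A \<union> b ` {k<..<CARD('n)}"
  have "card ?T \<le> card A + card (b ` {k<..<CARD('n)})" by (rule card_Un_le)
  also have "card (b ` {k<..<CARD('n)}) \<le> CARD('n) - Suc k"
    using card_image_le[of "{k<..<CARD('n)}" b] by simp
  finally have "card ?T < CARD('n)" using A(2) k by linarith
  then have "dim ?T < DIM(real ^ 'n)"
    using dim_le_card'[of ?T] A(1) by simp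
  then obtain x where x: "x \<noteq> 0" "\<And>y. y \<in> span ?T \<Longrightarrow> orthogonal x y"
    by (rule orthogonal_to_subspace_exists) blast
  define c where "c = x /\<^sub>R norm x"
  have c: "c \<bullet> c = 1" using x(1) by (simp add: c_def dot_square_norm power2_eq_square)
  have cT: "c \<bullet> y = 0" if "y \<in> ?T" for y
    using x(2)[OF span_base[OF that]] by (simp add: c_def orthogonal_def)
  define d where "d = b k - c"
  \<comment> \<open>The reflection in the hyperplane orthogonal to \<open>d\<close>; for
    \<open>d = 0\<close> it is the identity.\<close>
  define g where "g v = v - (2 * (v \<bullet> d) / (d \<bullet> d)) *\<^sub>R d" for v
  have "linear g"
    by (rule linearI) (simp_all add: g_def inner_add_left algebra_simps add_divide_distrib)
  moreover have "g v \<bullet> g w = v \<bullet> w" for v w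
    by (simp add: g_def inner_diff_left inner_diff_right inner_commute field_simps)
  ultimately have g: "orthogonal_transformation g" by (simp add: orthogonal_transformation_def)
  have bk: "b k \<bullet> b k = 1" using orthonormal_familyD[OF b k k] by simp
  have gk: "g (b k) = c"
  proof (cases "d = 0")
    case True
    then show ?thesis by (simp add: g_def d_def)
  next
    case False
    have dd: "2 * (b k \<bullet> d) = d \<bullet> d"
      using bk c by (simp add: d_def inner_diff_left inner_diff_right inner_commute)
    have 1: "2 * (b k \<bullet> d) / (d \<bullet> d) = 1"
      using dd False by (metis div_self inner_eq_zero_iff)
    show ?thesis unfolding g_def 1 by (simp add: d_def)
  qed
  show ?thesis
  proof (intro exI[of _ "\<lambda>l. g (b l)"] conjI allI impI ballI)
    show "orthonormal_family (\<lambda>l. g (b l))" by (rule orthonormal_family_image[OF b g])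
    show "g (b l) = b l" if "k < l" "l < CARD('n)" for l
    proof -
      have "b l \<bullet> d = 0"
        using orthonormal_familyD[OF b that(2) k] that cT[of "b l"] by (simp add: d_def inner_diff_right inner_commute)
      then show ?thesis by (simp add: g_def)
    qed
    show "a \<bullet> g (b k) = 0" if "a \<in> A" for a
      using cT[of a] that by (simp add: gk inner_commute)
  qed
qed

text \<open>The position in the order, counted from 0. It translates between coordinates of
  \<open>real ^ 'n\<close> and frames indexed by natural numbers.\<close>

definition index_of :: "'n::{finite,wellorder} \<Rightarrow> nat" where
  "index_of i = card {..<i}"

lemma index_of_less: "i < j \<Longrightarrow> index_of i < index_of (j :: 'n::{finite,wellorder})"
  unfolding index_of_def by (intro psubset_card_mono) auto

lemma index_of_le_iff: "index_of i \<le> index_of j \<longleftrightarrow> i \<le> (j :: 'n::{finite,wellorder})"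
  by (metis index_of_less leD le_less_linear less_le_not_le order_le_less)

lemma bij_betw_index_of: "bij_betw (index_of :: 'n::{finite,wellorder} \<Rightarrow> nat) UNIV {..<CARD('n)}"
proof -
  have inj: "inj (index_of :: 'n \<Rightarrow> nat)"
    by (rule injI) (metis index_of_less less_irrefl linorder_less_linear)
  have "index_of i < CARD('n)" for i :: 'n
    unfolding index_of_def by (intro psubset_card_mono) auto
  then have "range (index_of :: 'n \<Rightarrow> nat) = {..<CARD('n)}"
    using inj by (intro card_subset_eq) (auto simp: card_image)
  with inj show ?thesis by (simp add: bij_betw_def)
qed

lemma index_of_less_card: "index_of (i :: 'n::{finite,wellorder}) < CARD('n)"
  using bij_betw_index_of[where 'n = 'n] by (auto simp: bij_betw_def)

text \<open>A linear substitute for taking absolute values of the coordinates: for almost every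
  \<open>v\<close> exactly one \<open>s\<close> makes all entries positive, and each fixed
  \<open>s\<close> gives an orthogonal map, under which integrals are invariant.\<close>

definition signed_coords :: "(nat \<Rightarrow> real ^ 'n::{finite,wellorder}) \<Rightarrow> 'n set \<Rightarrow> real ^ 'n::_ \<Rightarrow> real ^ 'n::_" where
  "signed_coords b s v = (\<chi> i. (if i \<in> s then - 1 else 1) * (v \<bullet> b (index_of i)))"

lemma orthogonal_transformation_signed_coords:
  fixes b :: "nat \<Rightarrow> real ^ 'n::{finite,wellorder}"
  assumes b: "orthonormal_family b"
  shows "orthogonal_transformation (signed_coords b s)"
  unfolding orthogonal_transformation_def
proof (intro conjI allI)
  show "linear (signed_coords b s)"
    by (rule linearI) (simp_all add: signed_coords_def vec_eq_iff inner_add_left algebra_simps)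
  fix v w :: "real ^ 'n::_"
  have "signed_coords b s v \<bullet> signed_coords b s w = (\<Sum>i::'n\<in>UNIV. (v \<bullet> b (index_of i)) * (w \<bullet> b (index_of i)))"
    unfolding inner_vec_def[of "signed_coords b s v"]
    by (intro sum.cong) (auto simp: signed_coords_def)
  also have "\<dots> = (\<Sum>l<CARD('n). (v \<bullet> b l) * (w \<bullet> b l))"
    by (rule sum.reindex_bij_betw[OF bij_betw_index_of])
  also have "\<dots> = v \<bullet> w" by (rule orthonormal_family_inner[OF b])
  finally show "signed_coords b s v \<bullet> signed_coords b s w = v \<bullet> w" .
qed

text \<open>In frame coordinates \<open>partial_proj\<close> is truncation, which is also how the
  generators of a path cone arise. Hence, for every \<open>s\<close>, the path cone is congruent to
  the cone over the projections.\<close>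

lemma path_cone_signed_coords:
  fixes b :: "nat \<Rightarrow> real ^ 'n::{finite,wellorder}"
  assumes b: "orthonormal_family b"
  shows "path_cone (signed_coords b s v) = signed_coords b s ` pos_hull ((\<lambda>j. partial_proj b j v) ` {..<CARD('n)})"
proof -
  have "partial_sum_vec (signed_coords b s v) i = signed_coords b s (partial_proj b (index_of i) v)" for i
  proof (rule vec_eq_iff[THEN iffD2, rule_format])
    fix m :: 'n
    have m: "index_of m < CARD('n)" by (rule index_of_less_card)
    have "partial_sum_vec (signed_coords b s v) i $ m = (\<Sum>j\<in>{..i}. if j = m then signed_coords b s v $ m else 0)"
      unfolding partial_sum_vec_def sum_component by (intro sum.cong) (auto simp: axis_def)
    also have "\<dots> = (if m \<le> i then signed_coords b s v $ m else 0)" by simp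
    also have "\<dots> = signed_coords b s (partial_proj b (index_of i) v) $ m"
      by (simp add: signed_coords_def partial_proj_inner[OF b m] index_of_le_iff)
    finally show "partial_sum_vec (signed_coords b s v) i $ m = signed_coords b s (partial_proj b (index_of i) v) $ m" .
  qed
  then have "range (partial_sum_vec (signed_coords b s v)) = signed_coords b s ` ((\<lambda>j. partial_proj b j v) ` range (index_of :: 'n \<Rightarrow> nat))"
    by (simp add: image_image)
  also have "range (index_of :: 'n \<Rightarrow> nat) = {..<CARD('n)}"
    using bij_betw_index_of[where 'n = 'n] by (simp add: bij_betw_def)
  finally show ?thesis
    unfolding path_cone_def
    by (simp add: pos_hull_linear_image orthogonal_transformation_linear[OF orthogonal_transformation_signed_coords[OF b]])
qed

lemma signed_coords_in_positive_sphere_iff: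
  fixes b :: "nat \<Rightarrow> real ^ 'n::{finite,wellorder}"
  assumes b: "orthonormal_family b" and v: "norm v = 1" "\<And>l. l < CARD('n) \<Longrightarrow> v \<bullet> b l \<noteq> 0"
  shows "signed_coords b s v \<in> positive_sphere \<longleftrightarrow> s = {i. v \<bullet> b (index_of i) < 0}"
proof -
  have "v \<bullet> b (index_of i) \<noteq> 0" for i :: 'n
    by (intro v(2) index_of_less_card)
  then have "0 < signed_coords b s v $ i \<longleftrightarrow> (i \<in> s \<longleftrightarrow> v \<bullet> b (index_of i) < 0)" for i
    by (auto simp: signed_coords_def less_le)
  then show ?thesis
    using v(1) orthogonal_transformation_norm[OF orthogonal_transformation_signed_coords[OF b]]
    by (auto simp: positive_sphere_def)
qed

text \<open>The coordinate maps for \<open>{}\<close> and \<open>{i0}\<close> differ in the sign of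
  one row, so one followed by the inverse of the other is the reflection negating b_0.\<close>

lemma reflection_exists:
  fixes b :: "nat \<Rightarrow> real ^ 'n::{finite,wellorder}"
  assumes b: "orthonormal_family b"
  obtains r where "orthogonal_transformation r" "det (matrix r) = - 1"
    "\<And>l. 0 < l \<Longrightarrow> l < CARD('n) \<Longrightarrow> r (b l) = b l"
proof -
  obtain i0 :: 'n where i0: "index_of i0 = 0"
    using bij_betw_index_of by (metis bij_betw_iff_bijections lessThan_iff zero_less_card_finite)
  let ?T = "signed_coords b {}" and ?T' = "signed_coords b {i0}"
  have T: "orthogonal_transformation ?T" and T': "orthogonal_transformation ?T'"
    by (rule orthogonal_transformation_signed_coords[OF b])+
  define r where "r = inv ?T \<circ> ?T'"
  have r: "orthogonal_transformation r"
    unfolding r_def by (intro orthogonal_transformation_compose orthogonal_transformation_inv T T')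
  have Tr: "?T (r v) = ?T' v" for v
    by (simp add: r_def orthogonal_transformation_surj[OF T] surj_f_inv_f)
  have row_eq: "(\<chi> i. if i = i0 then row i0 (matrix ?T) else row i (matrix ?T)) = matrix ?T"
    by (simp add: vec_eq_iff row_def)
  have "matrix ?T' = (\<chi> i. if i = i0 then (- 1) *s row i0 (matrix ?T) else row i (matrix ?T))"
    by (simp add: vec_eq_iff row_def matrix_def signed_coords_def)
  then have det': "det (matrix ?T') = - det (matrix ?T)"
    using det_row_mul[of i0 "- 1" "\<lambda>i. row i0 (matrix ?T)" "\<lambda>i. row i (matrix ?T)"] by (simp add: row_eq)
  have "?T' = ?T \<circ> r" using Tr by auto
  then have "det (matrix ?T') = det (matrix ?T) * det (matrix r)"
    using matrix_compose[OF orthogonal_transformation_linear[OF r] orthogonal_transformation_linear[OF T]]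
    by (simp add: det_mul)
  moreover have "det (matrix ?T) \<noteq> 0"
    using T det_orthogonal_matrix[of "matrix ?T"] by (auto simp: orthogonal_transformation_matrix)
  ultimately have "det (matrix r) = - 1"
    using det' mult_left_cancel[of "det (matrix ?T)" "det (matrix r)" "- 1"] by simp
  moreover have "r (b l) = b l" if l: "0 < l" "l < CARD('n)" for l
  proof -
    have "b l \<bullet> b (index_of i0) = 0"
      using orthonormal_familyD[OF b l(2), of 0] l i0 by simp
    then have "?T' (b l) = ?T (b l)"
      by (auto simp: signed_coords_def vec_eq_iff)
    then have "?T (r (b l)) = ?T (b l)" by (simp add: Tr)
    then show ?thesis using orthogonal_transformation_inj[OF T] by (simp add: inj_eq)
  qed
  ultimately show thesis using r that by blast
qed

subsection \<open>Averaging over the sphere\<close>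

context invariant_simple_cone_valuation
begin

text \<open>Base case of the averaging: all generators are projections of \<open>v\<close>. The cone
  is then congruent to a path cone, and its signed value is odd under reflection in b_0. The
  bijection \<open>pos\<close> only reorders the generators.\<close>

lemma vanishing_mean_orthoscheme:
  fixes \<sigma> :: "(real ^ 'n::_) measure"
  assumes \<sigma>: "uniform_sphere_measure \<sigma>"
    and int: "set_integrable (completion \<sigma>) positive_sphere (\<lambda>a. \<mu> (path_cone a))"
    and pos: "bij_betw pos UNIV {..<CARD('n)}"
    and b: "orthonormal_family b"
  shows "vanishing_mean \<sigma> (\<lambda>v. signed_value (\<lambda>i. partial_proj b (pos i) v))"
proof -
  define h where "h a = indicator positive_sphere a * \<mu> (path_cone a)" for a
  let ?T = "signed_coords b"
  let ?D = "\<lambda>v. sgn (det (\<chi> i. partial_proj b (pos i) v))"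
  let ?F = "\<lambda>v. signed_value (\<lambda>i. partial_proj b (pos i) v)"
  have T: "orthogonal_transformation (?T s)" for s
    by (rule orthogonal_transformation_signed_coords[OF b])
  have hint: "integrable (completion \<sigma>) h"
    using int by (simp add: set_integrable_def h_def[abs_def])
  \<comment> \<open>The hypothesis gives measurability for the completion only; \<open>h'\<close> is
    a version measurable for \<sigma> itself.\<close>
  then obtain h' where h': "h' \<in> borel_measurable \<sigma>" "AE a in \<sigma>. h a = h' a"
    using completion_ex_borel_measurable_real[OF borel_measurable_integrable] by blast
  have "integrable (completion \<sigma>) h'"
    using integrable_cong_AE_imp[OF hint measurable_completion[OF h'(1)] AE_completion[OF h'(2)]] .
  then have h'int: "integrable \<sigma> h'" by (simp add: integrable_completion[OF h'(1)])
  \<comment> \<open>Almost surely a single sign pattern \<open>s\<close> lands in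
    \<open>positive_sphere\<close>, so the sum over all patterns is the value of \<mu> on the
    orthoscheme.\<close>
  define f where "f v = ?D v * (\<Sum>s\<in>UNIV. h' (?T s v))" for v
  have sum_int: "integrable \<sigma> (\<lambda>v. \<Sum>s\<in>UNIV. h' (?T s v))"
    by (intro Bochner_Integration.integrable_sum integrable_orthogonal_transformation[OF \<sigma> T h'int])
  have "continuous_on UNIV (\<lambda>v. det (\<chi> i. partial_proj b (pos i) v))"
    unfolding det_def partial_proj_def by (intro continuous_intros)
  then have "(\<lambda>v. det (\<chi> i. partial_proj b (pos i) v)) \<in> borel_measurable borel"
    by (rule borel_measurable_continuous_onI)
  then have D: "?D \<in> borel_measurable borel"
    unfolding sgn_if by measurable
  have fint: "integrable \<sigma> f"
  proof (rule Bochner_Integration.integrable_bound[OF sum_int])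
    show "f \<in> borel_measurable \<sigma>"
      unfolding f_def[abs_def] using sum_int
      by (intro borel_measurable_times borel_measurable_uniform_sphere_measure[OF \<sigma> D]) auto
    show "AE v in \<sigma>. norm (f v) \<le> norm (\<Sum>s\<in>UNIV. h' (?T s v))"
      by (simp add: f_def abs_mult abs_sgn_eq)
  qed
  have "AE v in \<sigma>. \<forall>l\<in>{..<CARD('n)}. v \<bullet> b l \<noteq> 0"
  proof (intro AE_finite_allI)
    fix l assume "l \<in> {..<CARD('n)}"
    then have "b l \<noteq> 0" using orthonormal_familyD[OF b, of l l] by auto
    then show "AE v in \<sigma>. v \<bullet> b l \<noteq> 0" by (rule AE_inner_neq_0[OF \<sigma>])
  qed simp
  moreover have "AE v in \<sigma>. \<forall>s\<in>UNIV. h (?T s v) = h' (?T s v)"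
    by (intro AE_finite_allI AE_orthogonal_transformation[OF \<sigma> T h'(2)]) simp
  moreover have "AE v in \<sigma>. norm v = 1"
    by (rule AE_I2) (simp add: uniform_sphere_measure_space[OF \<sigma>])
  ultimately have F_eq_f: "AE v in \<sigma>. ?F v = f v"
  proof eventually_elim
    case (elim v)
    let ?C = "pos_hull ((\<lambda>j. partial_proj b j v) ` {..<CARD('n)})"
    have \<mu>T: "\<mu> (path_cone (?T s v)) = \<mu> ?C" for s
      using orth_inv T by (simp add: path_cone_signed_coords[OF b] orthogonally_invariant_def)
    have "?T s v \<in> positive_sphere \<longleftrightarrow> s = {i. v \<bullet> b (index_of i) < 0}" for s
      using elim by (intro signed_coords_in_positive_sphere_iff[OF b]) auto
    then have "h (?T s v) = (if s = {i. v \<bullet> b (index_of i) < 0} then \<mu> ?C else 0)" for s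
      by (simp add: h_def \<mu>T)
    then have "(\<Sum>s\<in>UNIV. h' (?T s v)) = \<mu> ?C" using elim by simp
    moreover have "range (\<lambda>i. partial_proj b (pos i) v) = (\<lambda>j. partial_proj b j v) ` {..<CARD('n)}"
      using pos by (simp add: bij_betw_def image_image[of "\<lambda>j. partial_proj b j v" pos UNIV, symmetric])
    ultimately show ?case by (simp add: signed_value_def f_def)
  qed
  obtain r where r: "orthogonal_transformation r" "det (matrix r) = - 1"
    "\<And>l. 0 < l \<Longrightarrow> l < CARD('n) \<Longrightarrow> r (b l) = b l"
    using reflection_exists[OF b] by blast
  \<comment> \<open>Only frame vectors with positive index enter \<open>partial_proj\<close>;
    \<open>r\<close> fixes these and preserves inner products, so it commutes with the
    projections.\<close>
  have "partial_proj b j (r v) = r (partial_proj b j v)" for j v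
  proof -
    have lin: "linear r" using r(1) by (rule orthogonal_transformation_linear)
    have "r v \<bullet> b l = v \<bullet> b l" if "0 < l" "l < CARD('n)" for l
      using r that by (metis orthogonal_transformation_def)
    then show ?thesis
      using r(3) by (simp add: partial_proj_def linear_diff[OF lin] linear_sum[OF lin] linear_cmul[OF lin])
  qed
  then have F_odd: "?F (r v) = - ?F v" for v
    using signed_value_orthogonal[OF r(1), of "\<lambda>i. partial_proj b (pos i) v"] r(2) by simp
  have "AE v in \<sigma>. f (r v) = - f v"
    using F_eq_f AE_orthogonal_transformation[OF \<sigma> r(1) F_eq_f]
    by eventually_elim (simp add: F_odd)
  then have "(\<integral>v. f (r v) \<partial>\<sigma>) = (\<integral>v. - f v \<partial>\<sigma>)"
    using fint integrable_orthogonal_transformation[OF \<sigma> r(1) fint] by (intro integral_cong_AE) auto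
  then have "(\<integral>v. f v \<partial>\<sigma>) = 0"
    using integral_orthogonal_transformation[OF \<sigma> r(1), of f] fint by simp
  then show ?thesis
    using fint F_eq_f by (auto simp: vanishing_mean_def)
qed

text \<open>The cocycle relation with \<open>z = partial_proj b k v\<close> replaces one of the \<open>k + 1\<close> deterministic
  generators by the projection of \<open>v\<close> to their span. After transposing the position of the replaced index with
  position \<open>k\<close> and rotating the frame, this is an instance of the induction hypothesis.\<close>

lemma vanishing_mean_partial_orthoscheme:
  fixes \<sigma> :: "(real ^ 'n::_) measure"
  assumes \<sigma>: "uniform_sphere_measure \<sigma>"
    and int: "set_integrable (completion \<sigma>) positive_sphere (\<lambda>a. \<mu> (path_cone a))"
    and "k \<le> CARD('n)"
    and "bij_betw pos UNIV {..<CARD('n)}"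
    and "orthonormal_family b"
    and "\<And>i l. pos i < k \<Longrightarrow> k \<le> l \<Longrightarrow> l < CARD('n) \<Longrightarrow> y i \<bullet> b l = 0"
  shows "vanishing_mean \<sigma> (\<lambda>v. signed_value (\<lambda>i. if pos i < k then y i else partial_proj b (pos i) v))"
  using assms(3-)
proof (induction k arbitrary: pos b)
  case 0
  then show ?case using vanishing_mean_orthoscheme[OF \<sigma> int, of pos b] by simp
next
  case (Suc k)
  note pos = Suc.prems(2) and b = Suc.prems(3) and y = Suc.prems(4)
  have k: "k < CARD('n)" using Suc.prems(1) by simp
  define I where "I = {i. pos i < Suc k}"
  define w where "w v i = (if pos i < Suc k then y i else partial_proj b (pos i) v)" for v i
  let ?p = "partial_proj b k"
  have wI: "w v ` I = y ` I" "inj_on (w v) I = inj_on y I" for v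
    by (auto simp: w_def I_def inj_on_def)
  have inj: "inj pos" and rng: "range pos = {..<CARD('n)}" using pos by (simp_all add: bij_betw_def)
  have "pos ` I = {..<Suc k}"
  proof -
    have "pos ` I = range pos \<inter> {..<Suc k}" by (auto simp: I_def)
    then show ?thesis using rng k by auto
  qed
  then have cardI: "card I = Suc k"
    using inj by (metis card_image card_lessThan inj_on_subset subset_UNIV)
  obtain q where q: "pos q = k" using rng k by (metis imageE lessThan_iff)
  \<comment> \<open>Dropping \<open>m\<close> leaves at most k fixed generators, which leaves room
    to turn b_k orthogonal to all of them.\<close>
  have replaced: "vanishing_mean \<sigma> (\<lambda>v. signed_value ((w v)(m := ?p v)))" if m: "m \<in> I" for m
  proof -
    have card_le: "card (y ` (I - {m})) \<le> k"
      using card_image_le[of "I - {m}" y] m cardI by simp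
    have orth: "a \<bullet> b l = 0" if "a \<in> y ` (I - {m})" "k < l" "l < CARD('n)" for a l
      using that y by (auto simp: I_def)
    obtain b' where b': "orthonormal_family b'" "\<And>l. k < l \<Longrightarrow> l < CARD('n) \<Longrightarrow> b' l = b l"
      "\<And>a. a \<in> y ` (I - {m}) \<Longrightarrow> a \<bullet> b' k = 0"
      using orthonormal_family_replace[OF b k finite_imageI[OF finite] card_le orth] by blast
    \<comment> \<open>Index \<open>m\<close> moves to position k, where the projection
      \<open>?p v\<close> belongs, and \<open>q\<close> takes the vacated position.\<close>
    define pos' where "pos' = pos \<circ> Transposition.transpose m q"
    have pos'_simps: "pos' m = k" "pos' q = pos m" "\<And>i. i \<noteq> m \<Longrightarrow> i \<noteq> q \<Longrightarrow> pos' i = pos i"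
      by (simp_all add: pos'_def q)
    have ne: "pos i \<noteq> k" if "i \<noteq> q" for i
      using that inj q by (metis injD)
    have pos': "bij_betw pos' UNIV {..<CARD('n)}"
      unfolding pos'_def by (rule bij_betw_trans[OF _ pos]) (simp add: bij_transpose)
    have mk: "pos m < Suc k" using m by (simp add: I_def)
    have less_iff: "pos' i < k \<longleftrightarrow> i \<noteq> m \<and> pos i < Suc k" for i
      using pos'_simps ne mk q by (cases "i = m"; cases "i = q") (auto simp: less_Suc_eq)
    have "vanishing_mean \<sigma> (\<lambda>v. signed_value (\<lambda>i. if pos' i < k then y i else partial_proj b' (pos' i) v))"
    proof (rule Suc.IH[OF _ pos' b'(1)])
      fix i l assume i: "pos' i < k" and l: "k \<le> l" "l < CARD('n)"
      have "i \<in> I - {m}" using i by (simp add: less_iff I_def)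
      then show "y i \<bullet> b' l = 0"
        using l b'(2,3) y by (cases "l = k") (auto simp: I_def)
    qed (use k in simp)
    \<comment> \<open>The new frame agrees with the old one beyond k, and
      \<open>partial_proj\<close> at positions from k on sees nothing else.\<close>
    also have "(\<lambda>v. signed_value (\<lambda>i. if pos' i < k then y i else partial_proj b' (pos' i) v)) =
      (\<lambda>v. signed_value ((w v)(m := ?p v)))"
    proof (intro ext arg_cong[where f = signed_value])
      fix v i
      have "partial_proj b' j v = partial_proj b j v" if "k \<le> j" for j
        using b'(2) that by (intro partial_proj_cong) simp
      moreover have "pos' i = pos i" if "\<not> pos i < Suc k"
        using that pos'_simps(3) q mk by (metis lessI)
      ultimately show "(if pos' i < k then y i else partial_proj b' (pos' i) v) = ((w v)(m := ?p v)) i"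
        by (cases "i = m") (auto simp: less_iff w_def pos'_simps)
    qed
    finally show ?thesis .
  qed
  have "b k \<noteq> 0" using orthonormal_familyD[OF b k k] by auto
  then have "AE v in \<sigma>. v \<bullet> b k \<noteq> 0" by (rule AE_inner_neq_0[OF \<sigma>])
  \<comment> \<open>The cocycle relation needs a nonzero vector; the coordinate of the projection
    along b_k is that of \<open>v\<close>.\<close>
  then have p0: "AE v in \<sigma>. ?p v \<noteq> 0"
    by eventually_elim (metis b inner_zero_left k order_refl partial_proj_inner)
  show ?case
  proof (cases "inj_on y I \<and> independent (y ` I)")
    case False
    then have "signed_value (w v) = 0" for v
      by (intro signed_value_dependent[of _ I]) (simp add: wI)
    then show ?thesis by (simp add: w_def[abs_def])
  next
    case True
    \<comment> \<open>The space \<open>?V\<close> has dimension at most k + 1 and contains the k + 1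
      independent generators, which therefore span it; the projection lies in
      \<open>?V\<close>.\<close>
    have p_span: "?p v \<in> span (w v ` I)" for v
    proof -
      let ?V = "{x. \<forall>l. k < l \<longrightarrow> l < CARD('n) \<longrightarrow> x \<bullet> b l = 0}"
      have "?V \<subseteq> span (b ` {..k})"
      proof
        fix x assume x: "x \<in> ?V"
        have "x = (\<Sum>l<CARD('n). (x \<bullet> b l) *\<^sub>R b l)" by (simp add: orthonormal_family_expand[OF b])
        also have "\<dots> \<in> span (b ` {..k})"
        proof (rule span_sum)
          fix l assume "l \<in> {..<CARD('n)}"
          then show "(x \<bullet> b l) *\<^sub>R b l \<in> span (b ` {..k})"
            using x by (cases "l \<le> k") (auto intro: span_scale span_base simp: span_zero)
        qed
        finally show "x \<in> span (b ` {..k})" .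
      qed
      then have "dim ?V \<le> card (b ` {..k})" by (intro dim_le_card) auto
      also have "\<dots> \<le> Suc k" using card_image_le[of "{..k}" b] by simp
      also have "\<dots> = card (y ` I)" using True cardI by (simp add: card_image)
      finally have "?V \<subseteq> span (y ` I)"
        using True y by (intro card_ge_dim_independent) (auto simp: I_def)
      moreover have "?p v \<in> ?V" using partial_proj_inner[OF b] by auto
      ultimately show ?thesis by (auto simp: wI)
    qed
    have "vanishing_mean \<sigma> (\<lambda>v. \<Sum>m\<in>I. signed_value ((w v)(m := ?p v)))"
      by (intro vanishing_mean_sum replaced) auto
    then have "vanishing_mean \<sigma> (\<lambda>v. signed_value (w v))"
    proof (rule vanishing_mean_cong_AE)
      show "AE v in \<sigma>. signed_value (w v) = (\<Sum>m\<in>I. signed_value ((w v)(m := ?p v)))"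
        using p0 by eventually_elim (rule signed_value_cocycle[OF p_span])
    qed
    then show ?thesis by (simp add: w_def[abs_def])
  qed
qed

section \<open>From vanishing means to vanishing values\<close>

lemma orthonormal_family_exists: "\<exists>b :: nat \<Rightarrow> real ^ 'n::_. orthonormal_family b"
proof -
  let ?e = "inv (index_of :: 'n \<Rightarrow> nat)"
  have "index_of (?e l) = l" if "l < CARD('n)" for l
    using bij_betw_index_of[where 'n = 'n] that by (auto simp: bij_betw_def intro!: f_inv_into_f)
  then have "?e l = ?e k \<longleftrightarrow> l = k" if "l < CARD('n)" "k < CARD('n)" for l k
    using that by metis
  then show ?thesis
    by (intro exI[of _ "\<lambda>l. axis (?e l) 1"]) (auto simp: orthonormal_family_def inner_axis_axis)
qed

text \<open>At k = n no projection is left and the orthogonality condition is vacuous, so the signed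
  value is a constant function of \<open>v\<close> with mean zero on a probability space.\<close>

lemma signed_value_eq_0:
  fixes \<sigma> :: "(real ^ 'n::_) measure"
  assumes \<sigma>: "uniform_sphere_measure \<sigma>"
    and int: "set_integrable (completion \<sigma>) positive_sphere (\<lambda>a. \<mu> (path_cone a))"
  shows "signed_value y = 0"
proof -
  obtain b :: "nat \<Rightarrow> real ^ 'n::_" where b: "orthonormal_family b"
    using orthonormal_family_exists by blast
  have "vanishing_mean \<sigma> (\<lambda>v. signed_value (\<lambda>i. if index_of i < CARD('n) then y i else partial_proj b (index_of i) v))"
    by (rule vanishing_mean_partial_orthoscheme[OF \<sigma> int _ bij_betw_index_of b]) auto
  then have "vanishing_mean \<sigma> (\<lambda>v. signed_value y)" by (simp add: index_of_less_card)
  then show ?thesis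
    using emeasure_space_uniform_sphere_measure[OF \<sigma>] by (rule vanishing_mean_const)
qed

text \<open>For n independent generators the determinant is nonzero, so the value of \<mu> agrees
  with the signed value up to sign; \<open>mu_eq_0_from_simplicial\<close> handles all other
  cones.\<close>

lemma mu_polyhedral_cone_eq_0:
  fixes \<sigma> :: "(real ^ 'n::_) measure"
  assumes \<sigma>: "uniform_sphere_measure \<sigma>"
    and int: "set_integrable (completion \<sigma>) positive_sphere (\<lambda>a. \<mu> (path_cone a))"
    and "polyhedral_cone D"
  shows "\<mu> D = 0"
proof -
  have "\<mu> (pos_hull S) = 0" if S: "finite S" "independent S" "card S = DIM(real ^ 'n::_)" for S :: "(real ^ 'n::_) set"
  proof -
    obtain y :: "'n \<Rightarrow> real ^ 'n::_" where y: "bij_betw y UNIV S"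
      using S by (metis DIM_cart DIM_real finite_class.finite_UNIV finite_same_card_bij mult.right_neutral)
    have "rows (\<chi> i. y i) = S"
      using y by (auto simp: rows_def row_def bij_betw_def vec_nth_inverse full_SetCompr_eq)
    then have "rank (\<chi> i. y i) = CARD('n)"
      using S by (simp add: row_rank_def dim_eq_card_independent)
    then have "det (\<chi> i. y i) \<noteq> 0"
      using det_eq_0_rank[of "\<chi> i. y i"] by simp
    then show ?thesis
      using signed_value_eq_0[OF \<sigma> int, of y] y by (simp add: signed_value_def bij_betw_def sgn_zero_iff)
  qed
  then show ?thesis
    using mu_eq_0_from_simplicial assms(3) by (auto simp: polyhedral_cone_def)
qed

end

theorem theorem4p4:
  fixes \<mu> :: "(real ^ 'n::{finite,wellorder}) set \<Rightarrow> real"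
    and \<sigma> :: "(real ^ 'n::_) measure"
  assumes "cone_valuation \<mu>"
    and "orthogonally_invariant \<mu>"
    and "\<And>D. polyhedral_cone D \<Longrightarrow> dim D < CARD('n) \<or> contains_line D \<Longrightarrow> \<mu> D = 0"
    and "uniform_sphere_measure \<sigma>"
    and "set_integrable (completion \<sigma>) positive_sphere (\<lambda>a. \<mu> (path_cone a))"
  shows "(\<forall>C. simplicial_cone C \<and> dim C = CARD('n) \<longrightarrow> \<mu> C = 0) \<and>
         (\<forall>D. polyhedral_cone D \<longrightarrow> \<mu> D = 0)"
proof -
  interpret invariant_simple_cone_valuation \<mu>
    using assms(1-3) by unfold_locales auto
  have "\<mu> D = 0" if "polyhedral_cone D" for D
    using mu_polyhedral_cone_eq_0[OF assms(4,5) that] .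
  then show ?thesis
    by (auto simp: simplicial_cone_def polyhedral_cone_def)
qed

end
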